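(* Let $d\ge 2$ and $r\ge 1$ be integers. Every subgroup of $\mathcal{N}_{d,r}$ satisfying the property $(\mathrm{FW}_{\mathrm{LocFin}})$ lies in the automorphism group of a cofinite rooted subforest of $\mathcal{T}_{d,r}$.
   Context: $\mathcal{T}_{d,r}$ is the rooted tree whose root has degree $r$ and all of whose other vertices have degree $d+1$ (i.e. $d$ children). A rooted subforest $F\subset\mathcal{T}_{d,r}$ is admissible if it is finite (possibly empty) and its root, if any, is the root of $\mathcal{T}_{d,r}$. The cofinite rooted subforest $F^C$ is obtained by deleting the vertices of $F$ and all edges with at least one endpoint in $F$; it is a rooted forest, with set of roots $\lambda(F^C)$ consisting of the children of vertices of $F$ that are not in $F$ (and the root of the tree if $F=\emptyset$). An almost automorphism is an equivalence class of triples $(\psi,F,F')$ with $F,F'$ admissible and $\psi\colon F^C\to F'^C$ a forest isomorphism sending $\lambda(F^C)$ bijectively onto $\lambda(F'^C)$; $(\psi_1,F_1,F_1')$ and $(\psi_2,F_2,F_2')$ are equivalent if there are admissible $F\supset F_1,F_2$ and $F'\supset F_1',F_2'$ such that $\psi_1,\psi_2$ induce the same rooted forest isomorphism $F^C\to F'^C$. The Neretin group $\mathcal{N}_{d,r}=\mathrm{AAut}(\mathcal{T}_{d,r})$ is the group of almost automorphisms. The automorphism group of $F^C$, as a subgroup of $\mathcal{N}_{d,r}$, consists of the elements having a representative $(\psi,F,F)$. A group satisfies the property $(\mathrm{FW}_{\mathrm{LocFin}})$ if all its actions on locally finite CAT(0) cube complexes admit global fixed points. *)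

theory Defs
  imports "HOL-Analysis.Analysis" "HOL-Algebra.Group_Action"
begin

section \<open>The rooted tree and its cofinite rooted subforests\<close>

text \<open>
  Vertices are words: the root is the empty word, the children of \<open>v\<close> are the words \<open>v @ [a]\<close>.
\<close>

definition tree_verts :: "nat \<Rightarrow> nat \<Rightarrow> nat list set" where
  "tree_verts d r = {v. (v \<noteq> [] \<longrightarrow> hd v < r) \<and> (\<forall>a\<in>set (tl v). a < d)}"

definition tree_adj :: "nat list \<Rightarrow> nat list \<Rightarrow> bool" where
  "tree_adj u v \<longleftrightarrow> (\<exists>a. v = u @ [a] \<or> u = v @ [a])"

text \<open>
  A subforest all of whose roots equal the root of the tree is either empty or a subtree containing
  that root, that is, it is a set of vertices which is closed under passing to the parent.
\<close>

definition admissible :: "nat \<Rightarrow> nat \<Rightarrow> nat list set \<Rightarrow> bool" where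
  "admissible d r F \<longleftrightarrow> finite F \<and> F \<subseteq> tree_verts d r \<and> (\<forall>u a. u @ [a] \<in> F \<longrightarrow> u \<in> F)"

definition cofinite_forest :: "nat \<Rightarrow> nat \<Rightarrow> nat list set \<Rightarrow> nat list set" where
  "cofinite_forest d r F = tree_verts d r - F"

definition forest_roots :: "nat \<Rightarrow> nat \<Rightarrow> nat list set \<Rightarrow> nat list set" where
  "forest_roots d r F =
     {v \<in> cofinite_forest d r F. (F = {} \<and> v = []) \<or> (\<exists>u\<in>F. \<exists>a. v = u @ [a])}"

definition forest_iso ::
  "nat \<Rightarrow> nat \<Rightarrow> nat list set \<Rightarrow> nat list set \<Rightarrow> (nat list \<Rightarrow> nat list) \<Rightarrow> bool" where
  "forest_iso d r F F' \<psi> \<longleftrightarrow>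
     bij_betw \<psi> (cofinite_forest d r F) (cofinite_forest d r F') \<and>
     (\<forall>u\<in>cofinite_forest d r F. \<forall>v\<in>cofinite_forest d r F.
        tree_adj (\<psi> u) (\<psi> v) \<longleftrightarrow> tree_adj u v) \<and>
     bij_betw \<psi> (forest_roots d r F) (forest_roots d r F')"


section \<open>The Neretin group\<close>

type_synonym aa_triple = "(nat list \<Rightarrow> nat list) \<times> nat list set \<times> nat list set"

definition aa_triples :: "nat \<Rightarrow> nat \<Rightarrow> aa_triple set" where
  "aa_triples d r = {(\<psi>, F, F'). admissible d r F \<and> admissible d r F' \<and>
     forest_iso d r F F' \<psi> \<and> \<psi> \<in> extensional (cofinite_forest d r F)}"

definition aa_rel :: "nat \<Rightarrow> nat \<Rightarrow> aa_triple rel" where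
  "aa_rel d r = {((\<psi>\<^sub>1, F\<^sub>1, F\<^sub>1'), (\<psi>\<^sub>2, F\<^sub>2, F\<^sub>2')).
     (\<psi>\<^sub>1, F\<^sub>1, F\<^sub>1') \<in> aa_triples d r \<and> (\<psi>\<^sub>2, F\<^sub>2, F\<^sub>2') \<in> aa_triples d r \<and>
     (\<exists>F F'. admissible d r F \<and> admissible d r F' \<and>
        F\<^sub>1 \<subseteq> F \<and> F\<^sub>2 \<subseteq> F \<and> F\<^sub>1' \<subseteq> F' \<and> F\<^sub>2' \<subseteq> F' \<and>
        forest_iso d r F F' \<psi>\<^sub>1 \<and> forest_iso d r F F' \<psi>\<^sub>2 \<and>
        (\<forall>v\<in>cofinite_forest d r F. \<psi>\<^sub>1 v = \<psi>\<^sub>2 v))}"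

text \<open>
  Two almost automorphisms \<open>A\<close> and \<open>B\<close> always have representatives \<open>(\<psi>\<^sub>2, F\<^sub>2, F\<^sub>3)\<close> and
  \<open>(\<psi>\<^sub>1, F\<^sub>1, F\<^sub>2)\<close> with a common middle term; \<open>A B\<close> is the class of \<open>(\<psi>\<^sub>2 \<circ> \<psi>\<^sub>1, F\<^sub>1, F\<^sub>3)\<close>, for any
  choice of such representatives.
\<close>

definition neretin_group :: "nat \<Rightarrow> nat \<Rightarrow> aa_triple set monoid" where
  "neretin_group d r =
     \<lparr>carrier = aa_triples d r // aa_rel d r,
      mult = (\<lambda>A B. \<Union>{aa_rel d r `` {(compose (cofinite_forest d r F\<^sub>1) \<psi>\<^sub>2 \<psi>\<^sub>1, F\<^sub>1, F\<^sub>3)} |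
                        \<psi>\<^sub>1 \<psi>\<^sub>2 F\<^sub>1 F\<^sub>2 F\<^sub>3. (\<psi>\<^sub>2, F\<^sub>2, F\<^sub>3) \<in> A \<and> (\<psi>\<^sub>1, F\<^sub>1, F\<^sub>2) \<in> B}),
      one = aa_rel d r `` {(restrict id (cofinite_forest d r {}), {}, {})}\<rparr>"

definition forest_aut_group :: "nat \<Rightarrow> nat \<Rightarrow> nat list set \<Rightarrow> aa_triple set set" where
  "forest_aut_group d r F = {A \<in> carrier (neretin_group d r). \<exists>\<psi>. (\<psi>, F, F) \<in> A}"


section \<open>CAT(0) cube complexes\<close>

definition cube :: "nat \<Rightarrow> (nat \<Rightarrow> real) set" where
  "cube n = {x \<in> topspace (Euclidean_space n). \<forall>i<n. 0 \<le> x i \<and> x i \<le> 1}"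

definition open_cube :: "nat \<Rightarrow> (nat \<Rightarrow> real) set" where
  "open_cube n = {x \<in> topspace (Euclidean_space n). \<forall>i<n. 0 < x i \<and> x i < 1}"

definition cube_corners :: "nat \<Rightarrow> (nat \<Rightarrow> real) set" where
  "cube_corners n = {x \<in> topspace (Euclidean_space n). \<forall>i<n. x i = 0 \<or> x i = 1}"

definition cube_isometry :: "nat \<Rightarrow> ((nat \<Rightarrow> real) \<Rightarrow> (nat \<Rightarrow> real)) \<Rightarrow> bool" where
  "cube_isometry n \<sigma> \<longleftrightarrow> bij_betw \<sigma> (cube n) (cube n) \<and>
     (\<forall>x\<in>cube n. \<forall>y\<in>cube n.
        L2_set (\<lambda>i. \<sigma> x i - \<sigma> y i) {..<n} = L2_set (\<lambda>i. x i - y i) {..<n})"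

text \<open>For \<open>k < n\<close>, the inclusion of the \<open>(n - 1)\<close>-cube into the \<open>n\<close>-cube as the face \<open>x\<^sub>k = e\<close>.\<close>

definition face_map :: "nat \<Rightarrow> real \<Rightarrow> (nat \<Rightarrow> real) \<Rightarrow> (nat \<Rightarrow> real)" where
  "face_map k e x = (\<lambda>j. if j < k then x j else if j = k then e else x (j - 1))"

text \<open>
  A cube complex is a space \<open>X\<close> with a set \<open>C\<close> of pairs \<open>(n, \<phi>)\<close>, where \<open>\<phi>\<close> is the
  characteristic map of an \<open>n\<close>-dimensional cell. The conditions say that \<open>X\<close> is obtained by gluing
  cubes isometrically along their faces: \<open>X\<close> is as a set the disjoint union of the open cells,
  the restriction of a characteristic map to a codimension one face is a characteristic map up to
  an isometry of the cube, and \<open>X\<close> has the quotient topology. Dimensions need not be bounded.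
\<close>

definition cube_complex :: "'x topology \<Rightarrow> (nat \<times> ((nat \<Rightarrow> real) \<Rightarrow> 'x)) set \<Rightarrow> bool" where
  "cube_complex X C \<longleftrightarrow>
     (\<forall>(n, \<phi>)\<in>C. \<phi> ` cube n \<subseteq> topspace X \<and> inj_on \<phi> (open_cube n)) \<and>
     (\<forall>x\<in>topspace X. \<exists>!c. c \<in> C \<and> x \<in> snd c ` open_cube (fst c)) \<and>
     (\<forall>(n, \<phi>)\<in>C. \<forall>k<n. \<forall>e\<in>{0, 1}. \<exists>\<psi> \<sigma>. (n - 1, \<psi>) \<in> C \<and> cube_isometry (n - 1) \<sigma> \<and>
        (\<forall>x\<in>cube (n - 1). \<phi> (face_map k e x) = \<psi> (\<sigma> x))) \<and>
     (\<forall>U. U \<subseteq> topspace X \<longrightarrow> (openin X U \<longleftrightarrow>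
        (\<forall>(n, \<phi>)\<in>C. openin (subtopology (Euclidean_space n) (cube n)) {x \<in> cube n. \<phi> x \<in> U})))"

definition complex_vertices :: "(nat \<times> ((nat \<Rightarrow> real) \<Rightarrow> 'x)) set \<Rightarrow> 'x set" where
  "complex_vertices C = {v. \<exists>\<phi>. (0, \<phi>) \<in> C \<and> v \<in> \<phi> ` cube 0}"

text \<open>
  The link of a vertex \<open>v\<close> has an oriented edge issuing from \<open>v\<close> as each of its vertices, and one
  \<open>(n - 1)\<close>-simplex for each corner of an \<open>n\<close>-cube that lies at \<open>v\<close>. An oriented edge is
  represented by its parametrisation \<open>[0, 1] \<rightarrow> X\<close>, so that a loop at \<open>v\<close> counts twice.
\<close>

definition corner_edge :: "((nat \<Rightarrow> real) \<Rightarrow> 'x) \<Rightarrow> (nat \<Rightarrow> real) \<Rightarrow> nat \<Rightarrow> (real \<Rightarrow> 'x)" where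
  "corner_edge \<phi> p k = (\<lambda>t\<in>{0..1}. \<phi> (p(k := if p k = 0 then t else 1 - t)))"

definition corners_at ::
  "(nat \<times> ((nat \<Rightarrow> real) \<Rightarrow> 'x)) set \<Rightarrow> 'x \<Rightarrow> (nat \<times> ((nat \<Rightarrow> real) \<Rightarrow> 'x) \<times> (nat \<Rightarrow> real)) set" where
  "corners_at C v = {(n, \<phi>, p). (n, \<phi>) \<in> C \<and> p \<in> cube_corners n \<and> \<phi> p = v}"

definition corner_edges ::
  "nat \<times> ((nat \<Rightarrow> real) \<Rightarrow> 'x) \<times> (nat \<Rightarrow> real) \<Rightarrow> (real \<Rightarrow> 'x) set" where
  "corner_edges = (\<lambda>(n, \<phi>, p). corner_edge \<phi> p ` {..<n})"

definition link_vertices ::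
  "(nat \<times> ((nat \<Rightarrow> real) \<Rightarrow> 'x)) set \<Rightarrow> 'x \<Rightarrow> (real \<Rightarrow> 'x) set" where
  "link_vertices C v = {corner_edge \<phi> p 0 | \<phi> p. (1, \<phi>, p) \<in> corners_at C v}"

text \<open>Simplices have distinct vertices and are determined by them.\<close>

definition link_simplicial :: "(nat \<times> ((nat \<Rightarrow> real) \<Rightarrow> 'x)) set \<Rightarrow> 'x \<Rightarrow> bool" where
  "link_simplicial C v \<longleftrightarrow>
     (\<forall>(n, \<phi>, p)\<in>corners_at C v. inj_on (corner_edge \<phi> p) {..<n}) \<and>
     inj_on corner_edges (corners_at C v)"

text \<open>Finitely many pairwise adjacent vertices span a simplex.\<close>

definition link_flag :: "(nat \<times> ((nat \<Rightarrow> real) \<Rightarrow> 'x)) set \<Rightarrow> 'x \<Rightarrow> bool" where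
  "link_flag C v \<longleftrightarrow>
     (\<forall>S. S \<subseteq> link_vertices C v \<and> finite S \<and> S \<noteq> {} \<and>
        (\<forall>a\<in>S. \<forall>b\<in>S. a \<noteq> b \<longrightarrow> {a, b} \<in> corner_edges ` corners_at C v) \<longrightarrow>
        S \<in> corner_edges ` corners_at C v)"

definition simply_connected_space :: "'x topology \<Rightarrow> bool" where
  "simply_connected_space X \<longleftrightarrow> path_connected_space X \<and>
     (\<forall>p. pathin X p \<and> p 0 = p 1 \<longrightarrow>
        (\<exists>a\<in>topspace X. homotopic_with (\<lambda>q. q 0 = q 1) (top_of_set {0..1}) X p (\<lambda>_. a)))"

definition CAT0_cube_complex :: "'x topology \<Rightarrow> (nat \<times> ((nat \<Rightarrow> real) \<Rightarrow> 'x)) set \<Rightarrow> bool" where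
  "CAT0_cube_complex X C \<longleftrightarrow>
     cube_complex X C \<and> topspace X \<noteq> {} \<and> simply_connected_space X \<and>
     (\<forall>v\<in>complex_vertices C. link_simplicial C v \<and> link_flag C v)"

definition locally_finite_complex :: "(nat \<times> ((nat \<Rightarrow> real) \<Rightarrow> 'x)) set \<Rightarrow> bool" where
  "locally_finite_complex C \<longleftrightarrow>
     (\<forall>v\<in>complex_vertices C. finite {(n, \<phi>) \<in> C. v \<in> \<phi> ` cube n})"


section \<open>The fixed-point property\<close>

definition cubical_map ::
  "(nat \<times> ((nat \<Rightarrow> real) \<Rightarrow> 'x)) set \<Rightarrow> ('x \<Rightarrow> 'x) \<Rightarrow> bool" where
  "cubical_map C f \<longleftrightarrow> (\<forall>(n, \<phi>)\<in>C. \<exists>\<psi> \<sigma>. (n, \<psi>) \<in> C \<and> cube_isometry n \<sigma> \<and>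
     (\<forall>x\<in>cube n. f (\<phi> x) = \<psi> (\<sigma> x)))"

text \<open>
  The first argument of \<open>FW_LocFin_on\<close> is the type that supplies the points of the cube complexes.
  A connected locally finite cube complex has only countably many cells, so its set of points
  has at most the cardinality of the continuum and the complex is isomorphic to one whose points
  are real numbers (with a topology unrelated to that of the reals). Hence the point type
  \<open>real\<close> covers the actions on all locally finite CAT(0) cube complexes.
\<close>

definition FW_LocFin_on :: "'x itself \<Rightarrow> ('g, 'b) monoid_scheme \<Rightarrow> bool" where
  "FW_LocFin_on T G \<longleftrightarrow>
     (\<forall>(X :: 'x topology) C \<alpha>.
        CAT0_cube_complex X C \<and> locally_finite_complex C \<and>
        group_action G (topspace X) \<alpha> \<and> (\<forall>g\<in>carrier G. cubical_map C (\<alpha> g)) \<longrightarrow>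
        (\<exists>x\<in>topspace X. \<forall>g\<in>carrier G. \<alpha> g x = x))"

abbreviation FW_LocFin :: "('g, 'b) monoid_scheme \<Rightarrow> bool" where
  "FW_LocFin \<equiv> FW_LocFin_on TYPE(real)"

end

theory Submission
  imports Defs "HOL-Library.FSet"
begin

text \<open>
  The group acts on a locally finite CAT(0) cube complex built from a set of balls with a
  parent-child relation. A ball is a reduced finite tree whose leaves are cones, that is, subtrees
  hanging at a vertex other than the root; a cone is identified with the formal union of the cones
  at its children. An almost automorphism moves all but finitely many cones to cones, and it
  extends uniquely to a permutation of the balls that preserves the relation. The vertices of the
  complex are the sets of balls that are closed under children, contain at most one parent of each
  ball, and differ from the set of all cones by finitely many balls. They form a family closed
  under intersections and medians, and the complex is the subcomplex of the infinite cube that they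
  span. Medians give the flag condition on links. A compact set lies in a finite subcomplex, which
  is contracted by removing maximal balls one at a time.

  The set of nonzero coordinates of a fixed point is an invariant vertex. Replacing it by the set
  of children of its elements removes a maximal ball that is not a cone, so after finitely many
  steps it consists of cones. These are the cones at the vertices of a cofinite subforest, on which
  the group then acts by automorphisms.
\<close>

section \<open>Cubes\<close>

text \<open>Each group element changes the set of cones by only finitely many balls, and this alone
  gives an action on a cube complex; but the complex of all sets at finite distance from the cones
  is far from locally finite. The two conditions on vertices cure this. Call an element of a vertex
  \<open>V\<close> without a parent in \<open>V\<close> an orphan; there are finitely many. A ball
  can be removed only if it is an orphan and added only if its children are orphans, and a ball is
  determined by its children. With closure under children alone, infinitely many formal unions could
  still be added. Formal unions enter because an almost automorphism may scatter the subtrees below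
  a vertex, so that the image of a cone is recorded only by the images of its children. The root of
  the tree is not a cone, since its \<open>r\<close> children need not be \<open>d\<close> in
  number; hence the subtree deleted at the end always contains it.\<close>

lemma ex_inj_countable_functions_real: "\<exists>f :: ('b::countable \<Rightarrow> real) \<Rightarrow> real. inj f"
proof -
  obtain h :: "nat set \<Rightarrow> real" where h: "inj h"
    using eqpoll_imp_lepoll[OF nat_sets_eqpoll_reals] unfolding lepoll_def by auto
  obtain k :: "real \<Rightarrow> nat set" where k: "inj k"
    using eqpoll_imp_lepoll[OF eqpoll_sym[OF nat_sets_eqpoll_reals]] unfolding lepoll_def by auto
  \<comment> \<open>The fixed-point property speaks of complexes whose points are reals, while here
    they are families of reals. Each real \<open>x b\<close> becomes a set of naturals, the family
    one subset of a countable set, and that subset one real.\<close>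
  define f where "f x = h (to_nat ` (SIGMA b:UNIV. k (x b)))" for x :: "'b \<Rightarrow> real"
  have "x = y" if "f x = f y" for x y
  proof
    fix b
    have "(SIGMA b:UNIV. k (x b)) = (SIGMA b:UNIV. k (y b))"
      using that h inj_image_eq_iff[OF inj_to_nat] unfolding f_def by (metis injD)
    then have "k (x b) = k (y b)" by blast
    with k show "x b = y b" by (simp add: injD)
  qed
  then show ?thesis by (meson injI)
qed

text \<open>A fixed choice for each set: \<open>cube_complex\<close> asks for exactly one
  characteristic map per open cell, so a cube must not occur once for every numbering of its
  directions. The price is that faces and images of cubes match only up to a permutation of
  coordinates.\<close>

definition enum_of :: "'b set \<Rightarrow> 'b \<Rightarrow> nat" where
  "enum_of S = (SOME f. bij_betw f S {..<card S})"

lemma bij_betw_enum_of: "finite S \<Longrightarrow> bij_betw (enum_of S) S {..<card S}"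
  unfolding enum_of_def
  using someI_ex[OF ex_bij_betw_finite_nat[of S]] by (simp add: atLeast0LessThan)

lemma enum_of_less: "finite S \<Longrightarrow> b \<in> S \<Longrightarrow> enum_of S b < card S"
  using bij_betw_enum_of bij_betwE by fastforce

section \<open>Coordinates and symmetries of the standard cubes\<close>

lemma cube_iff: "u \<in> cube n \<longleftrightarrow> (\<forall>i. 0 \<le> u i \<and> u i \<le> 1) \<and> (\<forall>i\<ge>n. u i = 0)"
  unfolding cube_def topspace_Euclidean_space
proof (intro iffI CollectI)
  assume "u \<in> {x \<in> {x. \<forall>i\<ge>n. x i = 0}. \<forall>i<n. 0 \<le> x i \<and> x i \<le> 1}"
  then have "i < n \<longrightarrow> 0 \<le> u i \<and> u i \<le> 1" "\<not> i < n \<longrightarrow> u i = 0" for i by auto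
  then show "(\<forall>i. 0 \<le> u i \<and> u i \<le> 1) \<and> (\<forall>i\<ge>n. u i = 0)"
    by (metis linorder_not_le order_refl zero_le_one)
qed auto

lemma open_cube_iff: "u \<in> open_cube n \<longleftrightarrow> (\<forall>i<n. 0 < u i \<and> u i < 1) \<and> (\<forall>i\<ge>n. u i = 0)"
  unfolding open_cube_def topspace_Euclidean_space by auto

lemma open_cube_subset: "open_cube n \<subseteq> cube n"
  unfolding open_cube_def cube_def by force

lemma cube_corners_iff: "u \<in> cube_corners n \<longleftrightarrow> (\<forall>i. u i = 0 \<or> u i = 1) \<and> (\<forall>i\<ge>n. u i = 0)"
  unfolding cube_corners_def topspace_Euclidean_space
  using linorder_not_le by auto

lemma cube_corners_subset: "cube_corners n \<subseteq> cube n"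
proof
  fix u assume "u \<in> cube_corners n"
  then have "u i = 0 \<or> u i = 1" "i \<ge> n \<longrightarrow> u i = 0" for i
    by (auto simp: cube_corners_iff)
  then show "u \<in> cube n"
    unfolding cube_iff by (metis order_refl zero_le_one)
qed

lemma cube_topology: "subtopology (Euclidean_space n) (cube n) = top_of_set (cube n)"
proof -
  have "cube n \<subseteq> {x. \<forall>i\<ge>n. x i = 0}" by (auto simp: cube_iff)
  then show ?thesis
    by (simp add: Euclidean_space_def subtopology_subtopology euclidean_product_topology Int_absorb1)
qed

lemma closed_cube: "closed (cube n)"
proof -
  have "cube n = (\<Inter>i. {u. 0 \<le> u i}) \<inter> (\<Inter>i. {u. u i \<le> 1}) \<inter> (\<Inter>i\<in>{n..}. {u. u i = 0})"
    by (auto simp: cube_iff)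
  moreover have "closed {u :: nat \<Rightarrow> real. 0 \<le> u i}" "closed {u :: nat \<Rightarrow> real. u i \<le> 1}"
    "closed {u :: nat \<Rightarrow> real. u i = 0}" for i
    by (intro closed_Collect_le closed_Collect_eq continuous_intros continuous_on_product_coordinates)+
  ultimately show ?thesis by (auto intro!: closed_Int closed_INT)
qed

lemma cube_isometry_permute:
  assumes \<tau>: "bij_betw \<tau> {..<n} {..<n}"
  shows "cube_isometry n (\<lambda>u i. if i < n then u (\<tau> i) else 0)" (is "cube_isometry n ?\<sigma>")
proof -
  define \<rho> where "\<rho> = inv_into {..<n} \<tau>"
  have \<rho>: "bij_betw \<rho> {..<n} {..<n}" unfolding \<rho>_def using \<tau> by (rule bij_betw_inv_into)
  have \<rho>\<tau>: "\<rho> (\<tau> i) = i" "\<tau> (\<rho> i) = i" "\<tau> i < n" "\<rho> i < n" if "i < n" for i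
    using that \<tau> \<rho> bij_betw_inv_into_left[OF \<tau>] bij_betw_inv_into_right[OF \<tau>]
    by (auto simp: \<rho>_def dest: bij_betwE)
  have "bij_betw ?\<sigma> (cube n) (cube n)"
  proof (rule bij_betw_byWitness[where f' = "\<lambda>u i. if i < n then u (\<rho> i) else 0"])
    show "\<forall>u\<in>cube n. (\<lambda>i. if i < n then ?\<sigma> u (\<rho> i) else 0) = u"
      by (auto simp: fun_eq_iff \<rho>\<tau> cube_iff)
    show "\<forall>u\<in>cube n. ?\<sigma> (\<lambda>i. if i < n then u (\<rho> i) else 0) = u"
      by (auto simp: fun_eq_iff \<rho>\<tau> cube_iff)
  qed (auto simp: cube_iff)
  moreover have "L2_set (\<lambda>i. ?\<sigma> x i - ?\<sigma> y i) {..<n} = L2_set (\<lambda>i. x i - y i) {..<n}" for x y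
    unfolding L2_set_def
    using sum.reindex_bij_betw[OF \<tau>, of "\<lambda>i. (x i - y i)\<^sup>2"] by simp
  ultimately show ?thesis unfolding cube_isometry_def by blast
qed

text \<open>Compares the chosen numbering with another one, \<open>f\<close>. Such an
  \<open>f\<close> arises on a face of a cube and on the image of a cube under a permutation, where
  the inherited numbering need not be the chosen one.\<close>

lemma enum_transition:
  assumes S: "finite S" and f: "bij_betw f S {..<card S}"
  obtains \<sigma> where "cube_isometry (card S) \<sigma>" "\<And>u b. b \<in> S \<Longrightarrow> \<sigma> u (enum_of S b) = u (f b)"
proof -
  define g where "g = inv_into S (enum_of S)"
  have e: "bij_betw (enum_of S) S {..<card S}" by (rule bij_betw_enum_of[OF S])
  then have g: "bij_betw g {..<card S} S" unfolding g_def by (rule bij_betw_inv_into)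
  have "bij_betw (f \<circ> g) {..<card S} {..<card S}" by (rule bij_betw_trans[OF g f])
  from cube_isometry_permute[OF this] show ?thesis
  proof (rule that)
    fix u b assume "b \<in> S"
    then show "(if enum_of S b < card S then u ((f \<circ> g) (enum_of S b)) else 0) = u (f b)"
      using bij_betw_inv_into_left[OF e] S by (simp add: g_def enum_of_less)
  qed
qed

section \<open>The cube complex of a median family of sets\<close>

text \<open>
  Points of the complex are functions \<open>'b \<Rightarrow> real\<close>; the injection \<open>code\<close> only serves to move
  them to another type. The assumption \<open>peel\<close> gives a free face of the subcomplex of all
  vertices between \<open>W\<close> and \<open>W \<union> Q\<close>.
\<close>

locale median_family =
  fixes \<V> :: "'b set set" and code :: "('b \<Rightarrow> real) \<Rightarrow> 'x"
  assumes inj_code: "inj code"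
    and nonempty: "\<V> \<noteq> {}"
    and inter: "V \<in> \<V> \<Longrightarrow> W \<in> \<V> \<Longrightarrow> V \<inter> W \<in> \<V>"
    and median: "U \<in> \<V> \<Longrightarrow> V \<in> \<V> \<Longrightarrow> W \<in> \<V> \<Longrightarrow> (U \<inter> V) \<union> (V \<inter> W) \<union> (U \<inter> W) \<in> \<V>"
    and finite_diff: "V \<in> \<V> \<Longrightarrow> W \<in> \<V> \<Longrightarrow> finite (V - W)"
    and peel: "W \<in> \<V> \<Longrightarrow> finite Q \<Longrightarrow> Q \<noteq> {} \<Longrightarrow> Q \<inter> W = {} \<Longrightarrow>
      \<exists>b\<in>Q. \<forall>V\<in>\<V>. b \<in> V \<longrightarrow> W \<subseteq> V \<longrightarrow> V \<subseteq> W \<union> Q \<longrightarrow> V - {b} \<in> \<V>"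
    and finite_neighbours: "V \<in> \<V> \<Longrightarrow> finite {b. sym_diff V {b} \<in> \<V>}"
begin

text \<open>The cube \<open>(V, S)\<close> has the vertices \<open>V - T\<close> for \<open>T \<subseteq> S\<close>.\<close>

definition cells :: "('b set \<times> 'b set) set" where
  "cells = {(V, S). finite S \<and> S \<subseteq> V \<and> (\<forall>T\<subseteq>S. V - T \<in> \<V>)}"

text \<open>Coordinates all equal to 1 give the largest vertex \<open>V\<close> of the cube,
  coordinates all equal to 0 the smallest one, \<open>V - S\<close>.\<close>

definition point :: "'b set \<Rightarrow> 'b set \<Rightarrow> (nat \<Rightarrow> real) \<Rightarrow> 'b \<Rightarrow> real" where
  "point V S u b = (if b \<in> S then u (enum_of S b) else if b \<in> V then 1 else 0)"

definition char_map :: "'b set \<Rightarrow> 'b set \<Rightarrow> (nat \<Rightarrow> real) \<Rightarrow> 'x" where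
  "char_map V S u = code (point V S u)"

definition complex :: "(nat \<times> ((nat \<Rightarrow> real) \<Rightarrow> 'x)) set" where
  "complex = (\<lambda>(V, S). (card S, char_map V S)) ` cells"

text \<open>The open cell through a point can be read off from the point: \<open>supp x\<close> is
  the largest vertex of the cube and \<open>frac_set x\<close> the set of its directions.\<close>

definition supp :: "('b \<Rightarrow> real) \<Rightarrow> 'b set" where "supp x = {b. x b \<noteq> 0}"
definition frac_set :: "('b \<Rightarrow> real) \<Rightarrow> 'b set" where "frac_set x = {b. x b \<noteq> 0 \<and> x b \<noteq> 1}"

definition points :: "('b \<Rightarrow> real) set" where
  "points = {x. (\<forall>b. 0 \<le> x b \<and> x b \<le> 1) \<and> (supp x, frac_set x) \<in> cells}"

definition coords :: "'b set \<Rightarrow> ('b \<Rightarrow> real) \<Rightarrow> nat \<Rightarrow> real" where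
  "coords S x i = (if i < card S then x (inv_into S (enum_of S) i) else 0)"

definition space :: "'x topology" where
  "space = topology (\<lambda>U. U \<subseteq> code ` points \<and>
     (\<forall>(V, S)\<in>cells. openin (top_of_set (cube (card S))) {u \<in> cube (card S). char_map V S u \<in> U}))"

lemma code_eq_iff [simp]: "code x = code y \<longleftrightarrow> x = y"
  using inj_code by (auto dest: injD)

lemma cellsD:
  assumes "(V, S) \<in> cells"
  shows "finite S" "S \<subseteq> V" "T \<subseteq> S \<Longrightarrow> V - T \<in> \<V>" "V \<in> \<V>"
proof -
  show "finite S" "S \<subseteq> V" "T \<subseteq> S \<Longrightarrow> V - T \<in> \<V>" using assms by (auto simp: cells_def)
  have "V - {} \<in> \<V>" using assms unfolding cells_def by blast
  then show "V \<in> \<V>" by simp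
qed

lemma cells_face:
  assumes "(V, S) \<in> cells" "T \<subseteq> S" "S' \<subseteq> S - T"
  shows "(V - T, S') \<in> cells"
proof -
  have "V - T - R \<in> \<V>" if "R \<subseteq> S'" for R
  proof -
    have "V - (T \<union> R) \<in> \<V>" using that assms by (intro cellsD(3)[OF assms(1)]) auto
    then show ?thesis by (simp add: Diff_eq Int_assoc)
  qed
  moreover have "finite S'" using assms cellsD(1) by (meson Diff_subset finite_subset)
  ultimately show ?thesis using assms cellsD(2) unfolding cells_def by blast
qed

lemma point_coords:
  assumes "finite S" "\<And>b. b \<in> V - S \<Longrightarrow> x b = 1" "\<And>b. b \<notin> V \<Longrightarrow> x b = 0" "S \<subseteq> V"
  shows "point V S (coords S x) = x"
  using assms enum_of_less[OF assms(1)] bij_betw_inv_into_left[OF bij_betw_enum_of[OF assms(1)]]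
  by (auto simp: fun_eq_iff point_def coords_def)

lemma coords_point:
  assumes "finite S" "u \<in> cube (card S)"
  shows "coords S (point V S u) = u"
proof
  fix i
  show "coords S (point V S u) i = u i"
  proof (cases "i < card S")
    case True
    have e: "bij_betw (enum_of S) S {..<card S}" by (rule bij_betw_enum_of[OF assms(1)])
    have "inv_into S (enum_of S) i \<in> S" 
      using bij_betw_inv_into[OF e] True by (auto dest: bij_betwE)
    then show ?thesis
      using True bij_betw_inv_into_right[OF e] by (simp add: coords_def point_def)
  qed (use assms in \<open>auto simp: coords_def cube_iff\<close>)
qed

lemma point_in_points:
  assumes c: "(V, S) \<in> cells" and u: "u \<in> cube (card S)"
  shows "point V S u \<in> points"
proof -
  let ?x = "point V S u"
  \<comment> \<open>A coordinate 0 moves the largest vertex down, a coordinate 1 merely stops being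
    a direction; both amount to passing to a face.\<close>
  have "supp ?x = V - {b \<in> S. u (enum_of S b) = 0}"
    using cellsD(2)[OF c] by (auto simp: supp_def point_def)
  moreover have "frac_set ?x \<subseteq> S - {b \<in> S. u (enum_of S b) = 0}"
    by (auto simp: frac_set_def point_def split: if_splits)
  ultimately have "(supp ?x, frac_set ?x) \<in> cells"
    using cells_face[OF c, of "{b \<in> S. u (enum_of S b) = 0}" "frac_set ?x"] by auto
  then show ?thesis using u by (auto simp: points_def point_def cube_iff)
qed

lemma supp_frac_point:
  assumes c: "(V, S) \<in> cells" and u: "u \<in> open_cube (card S)"
  shows "supp (point V S u) = V" "frac_set (point V S u) = S"
proof -
  have "0 < u (enum_of S b) \<and> u (enum_of S b) < 1" if "b \<in> S" for b
    using that enum_of_less[OF cellsD(1)[OF c]] u by (auto simp: open_cube_iff)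
  then have in_S: "point V S u b \<noteq> 0 \<and> point V S u b \<noteq> 1" if "b \<in> S" for b
    using that by (fastforce simp: point_def)
  have not_in_S: "point V S u b = (if b \<in> V then 1 else 0)" if "b \<notin> S" for b
    using that by (simp add: point_def)
  have "point V S u b \<noteq> 0 \<longleftrightarrow> b \<in> V" "point V S u b \<noteq> 0 \<and> point V S u b \<noteq> 1 \<longleftrightarrow> b \<in> S" for b
    using cellsD(2)[OF c] in_S[of b] not_in_S[of b] by (cases "b \<in> S"; auto)+
  then show "supp (point V S u) = V" "frac_set (point V S u) = S"
    unfolding supp_def frac_set_def by simp_all
qed

lemma points_bounds: "x \<in> points \<Longrightarrow> 0 \<le> x b \<and> x b \<le> 1"
  by (simp add: points_def)

lemma point_supp_frac:
  assumes "x \<in> points"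
  shows "point (supp x) (frac_set x) (coords (frac_set x) x) = x"
    "coords (frac_set x) x \<in> open_cube (card (frac_set x))" "(supp x, frac_set x) \<in> cells"
proof -
  show c: "(supp x, frac_set x) \<in> cells" using assms by (simp add: points_def)
  show "point (supp x) (frac_set x) (coords (frac_set x) x) = x"
    by (rule point_coords) (use cellsD(1)[OF c] in \<open>auto simp: supp_def frac_set_def\<close>)
  have e: "bij_betw (enum_of (frac_set x)) (frac_set x) {..<card (frac_set x)}"
    by (rule bij_betw_enum_of[OF cellsD(1)[OF c]])
  have *: "inv_into (frac_set x) (enum_of (frac_set x)) i \<in> frac_set x" if "i < card (frac_set x)" for i
    using bij_betw_inv_into[OF e] that by (auto dest: bij_betwE)
  have "0 < x b \<and> x b < 1" if "b \<in> frac_set x" for b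
    using that points_bounds[OF assms, of b] by (auto simp: frac_set_def)
  with * show "coords (frac_set x) x \<in> open_cube (card (frac_set x))"
    by (simp add: open_cube_iff coords_def)
qed

lemma inj_on_char_map:
  assumes "finite S"
  shows "inj_on (char_map V S) (cube (card S))"
proof (rule inj_onI)
  fix u v assume u: "u \<in> cube (card S)" and v: "v \<in> cube (card S)"
    and eq: "char_map V S u = char_map V S v"
  from eq have "coords S (point V S u) = coords S (point V S v)" by (simp add: char_map_def)
  then show "u = v" unfolding coords_point[OF assms u] coords_point[OF assms v] .
qed

section \<open>The weak topology, and continuity and compactness in it\<close>

lemma openin_space:
  "openin space U \<longleftrightarrow> U \<subseteq> code ` points \<and>
     (\<forall>(V, S)\<in>cells. openin (top_of_set (cube (card S))) {u \<in> cube (card S). char_map V S u \<in> U})"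
proof -
  let ?P = "\<lambda>U. U \<subseteq> code ` points \<and>
     (\<forall>(V, S)\<in>cells. openin (top_of_set (cube (card S))) {u \<in> cube (card S). char_map V S u \<in> U})"
  have "istopology ?P"
    unfolding istopology_def
  proof (intro conjI allI impI)
    fix A B assume AB: "?P A" "?P B"
    show "A \<inter> B \<subseteq> code ` points" using AB by blast
    have "{u \<in> cube (card S). char_map V S u \<in> A \<inter> B} =
       {u \<in> cube (card S). char_map V S u \<in> A} \<inter> {u \<in> cube (card S). char_map V S u \<in> B}" for V S
      by blast
    then show "\<forall>(V, S)\<in>cells. openin (top_of_set (cube (card S))) {u \<in> cube (card S). char_map V S u \<in> A \<inter> B}"
      using AB by (intro ballI, clarify) (metis (no_types, lifting) case_prodD openin_Int)
  next
    fix K assume K: "\<forall>U\<in>K. ?P U"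
    show "\<Union>K \<subseteq> code ` points" using K by blast
    have eq: "{u \<in> cube (card S). char_map V S u \<in> \<Union>K} =
       \<Union>((\<lambda>A. {u \<in> cube (card S). char_map V S u \<in> A}) ` K)" for V S
      by blast
    show "\<forall>(V, S)\<in>cells. openin (top_of_set (cube (card S))) {u \<in> cube (card S). char_map V S u \<in> \<Union>K}"
      unfolding eq using K by (intro ballI, clarify, intro openin_Union) auto
  qed
  then show ?thesis by (simp add: space_def topology_inverse')
qed

lemma topspace_space: "topspace space = code ` points"
proof
  show "topspace space \<subseteq> code ` points"
    using openin_space openin_topspace by blast
  have "{u \<in> cube (card S). char_map V S u \<in> code ` points} = cube (card S)" if "(V, S) \<in> cells" for V S
    using that by (auto simp: char_map_def point_in_points)
  then have "openin space (code ` points)"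
    unfolding openin_space by auto
  then show "code ` points \<subseteq> topspace space" by (rule openin_subset)
qed

lemma closedin_space:
  "closedin space A \<longleftrightarrow> A \<subseteq> code ` points \<and>
     (\<forall>(V, S)\<in>cells. closedin (top_of_set (cube (card S))) {u \<in> cube (card S). char_map V S u \<in> A})"
proof -
  have "{u \<in> cube (card S). char_map V S u \<in> code ` points - A} =
    cube (card S) - {u \<in> cube (card S). char_map V S u \<in> A}" if "(V, S) \<in> cells" for V S
    using that by (auto simp: char_map_def point_in_points)
  then have "(\<forall>(V, S)\<in>cells. openin (top_of_set (cube (card S))) {u \<in> cube (card S). char_map V S u \<in> code ` points - A})
    \<longleftrightarrow> (\<forall>(V, S)\<in>cells. closedin (top_of_set (cube (card S))) {u \<in> cube (card S). char_map V S u \<in> A})"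
    unfolding closedin_def by (fastforce simp: Ball_def)
  then show ?thesis
    unfolding closedin_def[of space] topspace_space openin_space by blast
qed

text \<open>The subcomplex of the cubes whose vertices all lie between \<open>W\<close> and
  \<open>W \<union> Q\<close>. For finite \<open>Q\<close> it has finitely many cells even though
  \<open>W\<close> may be infinite, because elements of \<open>W\<close> are not directions of its
  cubes.\<close>

definition region :: "'b set \<Rightarrow> 'b set \<Rightarrow> ('b \<Rightarrow> real) set" where
  "region W Q = {x \<in> points. (\<forall>b\<in>W. x b = 1) \<and> (\<forall>b. b \<notin> W \<union> Q \<longrightarrow> x b = 0)}"

lemma finite_cells_between:
  assumes "finite Q"
  shows "finite {(V, S) \<in> cells. W \<subseteq> V - S \<and> V \<subseteq> W \<union> Q}" (is "finite ?K")
proof (rule finite_subset)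
  show "?K \<subseteq> ((\<lambda>R. W \<union> R) ` Pow Q) \<times> Pow Q"
  proof (rule subsetI)
    fix c assume "c \<in> ?K"
    then obtain V S where c: "c = (V, S)" and "(V, S) \<in> cells" "W \<subseteq> V - S" "V \<subseteq> W \<union> Q"
      by blast
    with cellsD(2) have "V = W \<union> (V \<inter> Q)" "S \<subseteq> Q" by blast+
    then show "c \<in> ((\<lambda>R. W \<union> R) ` Pow Q) \<times> Pow Q" unfolding c by blast
  qed
  show "finite (((\<lambda>R. W \<union> R) ` Pow Q) \<times> Pow Q)" using assms by simp
qed

definition decode :: "'x \<Rightarrow> 'b \<Rightarrow> real" where "decode = inv_into UNIV code"

lemma decode_code [simp]: "decode (code x) = x"
  using inj_code by (simp add: decode_def)

lemma continuous_map_coordinate: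
  "continuous_map space euclideanreal (\<lambda>y. decode y b)"
  unfolding continuous_map_def
proof (intro conjI allI impI)
  fix U :: "real set" assume U: "openin euclideanreal U"
  show "openin space {y \<in> topspace space. decode y b \<in> U}"
    unfolding openin_space
  proof (intro conjI ballI, use topspace_space in blast, clarify)
    fix V S assume c: "(V, S) \<in> cells"
    have "{u \<in> cube (card S). char_map V S u \<in> {y \<in> topspace space. decode y b \<in> U}}
      = cube (card S) \<inter> (\<lambda>u. point V S u b) -` U"
      using point_in_points[OF c] by (auto simp: char_map_def topspace_space)
    moreover have "continuous_on (cube (card S)) (\<lambda>u. point V S u b)"
      unfolding point_def
      by (cases "b \<in> S")
        (auto intro: continuous_on_subset[OF continuous_on_product_coordinates] continuous_on_const)
    ultimately show "openin (top_of_set (cube (card S)))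
        {u \<in> cube (card S). char_map V S u \<in> {y \<in> topspace space. decode y b \<in> U}}"
      using U by (simp add: continuous_openin_preimage_gen)
  qed
qed auto

text \<open>The weak topology may be finer than that of pointwise convergence, so continuity of the
  coordinates is not enough in general. It suffices inside a finite subcomplex: the preimage of a
  closed set is a finite union, over the closed cubes, of sets that are closed by continuity of the
  coordinates.\<close>

lemma continuous_map_into_region:
  assumes Q: "finite Q" and F: "\<And>z. z \<in> topspace Z \<Longrightarrow> F z \<in> region W Q"
    and cont: "\<And>b. continuous_map Z euclideanreal (\<lambda>z. F z b)"
  shows "continuous_map Z space (\<lambda>z. code (F z))"
  unfolding continuous_map_closedin
proof (intro conjI ballI allI impI)
  show "(\<lambda>z. code (F z)) \<in> topspace Z \<rightarrow> topspace space"
    using F by (auto simp: topspace_space region_def)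
next
  fix A assume A: "closedin space A"
  define K where "K = {(V, S) \<in> cells. W \<subseteq> V - S \<and> V \<subseteq> W \<union> Q}"
  define cl where "cl V S = {u \<in> cube (card S). char_map V S u \<in> A}" for V S
  \<comment> \<open>The parameters that \<open>F\<close> sends into \<open>A\<close> within the
    closed cube \<open>(V, S)\<close>. Coordinates outside \<open>Q\<close> are not tested because
    \<open>region\<close> prescribes them.\<close>
  define Y where "Y = (\<lambda>(V, S). {z \<in> topspace Z. (\<forall>b\<in>Q \<inter> (V - S). F z b = 1) \<and> (\<forall>b\<in>Q - V. F z b = 0)
      \<and> coords S (F z) \<in> cl V S})"
  have closed_cl: "closed (cl V S)" if "(V, S) \<in> K" for V S
    using A that closed_cube unfolding closedin_space cl_def K_def
    by (metis (no_types, lifting) case_prodD closedin_closed_eq mem_Collect_eq)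
  have cont_coords: "continuous_map Z euclidean (\<lambda>z. coords S (F z))" for S
    unfolding euclidean_product_topology[symmetric] continuous_map_componentwise_UNIV coords_def
    using cont by auto
  have "closedin Z (Y c)" if "c \<in> K" for c
  proof -
    obtain V S where c: "c = (V, S)" by force
    have one: "closedin Z {z \<in> topspace Z. F z b = a}" for a b
      using closedin_continuous_map_preimage[OF cont[of b], of "{a}"] by simp
    have "closedin Z {z \<in> topspace Z. coords S (F z) \<in> cl V S}"
      using closedin_continuous_map_preimage[OF cont_coords[of S], of "cl V S"] closed_cl that c by simp
    moreover have "closedin Z {z \<in> topspace Z. \<forall>b\<in>R. F z b = a}" for R a
    proof (cases "R = {}")
      case False
      then have "{z \<in> topspace Z. \<forall>b\<in>R. F z b = a} = (\<Inter>b\<in>R. {z \<in> topspace Z. F z b = a})" by auto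
      with False one show ?thesis by (auto intro!: closedin_INT)
    qed auto
    ultimately have "closedin Z ({z \<in> topspace Z. \<forall>b\<in>Q \<inter> (V - S). F z b = 1}
       \<inter> {z \<in> topspace Z. \<forall>b\<in>Q - V. F z b = 0} \<inter> {z \<in> topspace Z. coords S (F z) \<in> cl V S})"
      by blast
    also have "\<dots> = Y c" by (auto simp: Y_def c)
    finally show ?thesis .
  qed
  moreover have "finite K" unfolding K_def by (rule finite_cells_between[OF Q])
  ultimately have "closedin Z (\<Union>c\<in>K. Y c)" by (auto intro!: closedin_Union)
  moreover have "{z \<in> topspace Z. code (F z) \<in> A} = (\<Union>c\<in>K. Y c)"
  proof (intro Set.set_eqI iffI)
    fix z assume z: "z \<in> {z \<in> topspace Z. code (F z) \<in> A}"
    then have R: "F z \<in> region W Q" using F by blast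
    then have P: "F z \<in> points" by (simp add: region_def)
    let ?V = "supp (F z)" and ?S = "frac_set (F z)"
    have "(?V, ?S) \<in> K"
      using R point_supp_frac(3)[OF P] by (auto simp: K_def region_def supp_def frac_set_def)
    moreover have "z \<in> Y (?V, ?S)"
      using z point_supp_frac(1,2)[OF P] open_cube_subset
      by (auto simp: Y_def cl_def char_map_def supp_def frac_set_def)
    ultimately show "z \<in> (\<Union>c\<in>K. Y c)" by blast
  next
    fix z assume "z \<in> (\<Union>c\<in>K. Y c)"
    then obtain V S where c: "(V, S) \<in> K" and z: "z \<in> Y (V, S)" by auto
    have zZ: "z \<in> topspace Z" using z by (simp add: Y_def)
    then have R: "F z \<in> region W Q" using F by blast
    have cell: "(V, S) \<in> cells" and VW: "W \<subseteq> V - S" "V \<subseteq> W \<union> Q" using c by (auto simp: K_def)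
    have "point V S (coords S (F z)) = F z"
    proof (rule point_coords)
      show "F z b = 1" if "b \<in> V - S" for b
        using that VW z R by (cases "b \<in> W") (auto simp: region_def Y_def)
      show "F z b = 0" if "b \<notin> V" for b
        using that VW z R by (cases "b \<in> Q") (auto simp: region_def Y_def)
    qed (use cellsD[OF cell] in auto)
    then show "z \<in> {z \<in> topspace Z. code (F z) \<in> A}"
      using z zZ by (simp add: Y_def cl_def char_map_def)
  qed
  ultimately show "closedin Z {z \<in> topspace Z. code (F z) \<in> A}" by simp
qed

text \<open>Choose one point of \<open>K\<close> in each open cell that \<open>K\<close> meets. A
  closed cube contains only finitely many chosen points, so every set of chosen points is closed in
  the weak topology. An infinite choice would then have no accumulation point, against
  Bolzano-Weierstrass.\<close>

lemma compactin_finite_cells: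
  assumes K: "compactin space K"
  shows "finite ((\<lambda>x. (supp x, frac_set x)) ` {x \<in> points. code x \<in> K})"
proof (rule ccontr)
  define cell where "cell x = (supp x, frac_set x)" for x :: "'b \<Rightarrow> real"
  let ?I = "cell ` {x \<in> points. code x \<in> K}"
  assume "infinite ((\<lambda>x. (supp x, frac_set x)) ` {x \<in> points. code x \<in> K})"
  then have inf: "infinite ?I" by (simp add: cell_def)
  define g where "g = inv_into {x \<in> points. code x \<in> K} cell"
  have g: "g c \<in> points" "code (g c) \<in> K" "cell (g c) = c" if "c \<in> ?I" for c
    using that inv_into_into[OF that] f_inv_into_f[OF that] by (auto simp: g_def)
  let ?T = "(\<lambda>c. code (g c)) ` ?I"
  have "inj_on (\<lambda>c. code (g c)) ?I"
    by (rule inj_onI) (metis code_eq_iff g(3))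
  with inf have "infinite ?T" by (simp add: finite_image_iff)
  moreover have "?T \<subseteq> K" by (rule image_subsetI) (rule g(2))
  ultimately have ne: "K \<inter> space derived_set_of ?T \<noteq> {}"
    using compactin_imp_Bolzano_Weierstrass[OF K] by blast
  have closedT: "closedin space T'" if "T' \<subseteq> ?T" for T'
    unfolding closedin_space
  proof (intro conjI ballI, use that g(1) in blast, clarify)
    fix V S assume c: "(V, S) \<in> cells"
    let ?U = "{u \<in> cube (card S). char_map V S u \<in> T'}"
    \<comment> \<open>A point of the closed cube lies in the open cell of some face, whose largest
      vertex is \<open>V - R\<close> with \<open>R \<subseteq> S\<close> and whose directions form a
      subset of \<open>S\<close>.\<close>
    have "char_map V S ` ?U \<subseteq> (\<lambda>c. code (g c)) ` (((\<lambda>R. V - R) ` Pow S) \<times> Pow S)"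
    proof
      fix y assume "y \<in> char_map V S ` ?U"
      then obtain u where u: "u \<in> cube (card S)" "y = code (point V S u)" and "y \<in> T'"
        by (auto simp: char_map_def)
      with that obtain c where c': "c \<in> ?I" "y = code (g c)" by blast
      with u have "g c = point V S u" by simp
      with g(3)[OF c'(1)] have "c = (supp (point V S u), frac_set (point V S u))"
        by (simp add: cell_def)
      moreover have "supp (point V S u) = V - {b \<in> S. u (enum_of S b) = 0}"
        using cellsD(2)[OF c] by (auto simp: supp_def point_def)
      moreover have "frac_set (point V S u) \<subseteq> S"
        by (auto simp: frac_set_def point_def split: if_splits)
      ultimately have "c \<in> ((\<lambda>R. V - R) ` Pow S) \<times> Pow S" by blast
      then show "y \<in> (\<lambda>c. code (g c)) ` (((\<lambda>R. V - R) ` Pow S) \<times> Pow S)"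
        using c' by blast
    qed
    moreover have "finite ((\<lambda>c. code (g c)) ` (((\<lambda>R. V - R) ` Pow S) \<times> Pow S))"
      using cellsD(1)[OF c] by simp
    ultimately have "finite (char_map V S ` ?U)" by (rule finite_subset)
    moreover have "inj_on (char_map V S) ?U"
      using inj_on_char_map[OF cellsD(1)[OF c]] by (rule inj_on_subset) auto
    ultimately have "finite ?U" by (rule finite_imageD)
    then show "closedin (top_of_set (cube (card S))) ?U"
      by (intro closed_subset finite_imp_closed) auto
  qed
  obtain y where y: "y \<in> space derived_set_of ?T" using ne by blast
  let ?O = "topspace space - (?T - {y})"
  have "openin space ?O" using closedT[of "?T - {y}"] by blast
  moreover have "y \<in> ?O" using y by (auto simp: in_derived_set_of)
  ultimately obtain z where "z \<noteq> y" "z \<in> ?T" "z \<in> ?O"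
    using y unfolding in_derived_set_of by meson
  then show False by blast
qed

section \<open>Contracting loops one coordinate at a time\<close>

definition lower :: "'b \<Rightarrow> real \<Rightarrow> ('b \<Rightarrow> real) \<Rightarrow> 'b \<Rightarrow> real" where
  "lower b s x = x(b := (1 - s) * x b)"

text \<open>The assumption lets \<open>b\<close> be removed from those vertices of the cube of
  \<open>x\<close> that contain it. Hence adding \<open>b\<close> to the directions gives a cube
  again, and the lowered point travels inside that cube to its face without
  \<open>b\<close>.\<close>

lemma lower_in_points:
  assumes b: "\<forall>V\<in>\<V>. b \<in> V \<longrightarrow> W \<subseteq> V \<longrightarrow> V \<subseteq> W \<union> Q \<longrightarrow> V - {b} \<in> \<V>"
    and x: "x \<in> region W Q" and s: "s \<in> {0..1}"
  shows "lower b s x \<in> points"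
proof (cases "x b = 0 \<or> s = 0")
  case True
  then have "lower b s x = x" by (auto simp: lower_def fun_eq_iff)
  then show ?thesis using x by (simp add: region_def)
next
  case False
  let ?V = "supp x" and ?S = "frac_set x"
  have P: "x \<in> points" using x by (simp add: region_def)
  note cell = point_supp_frac(3)[OF P]
  have W: "W \<subseteq> ?V" "W \<inter> ?S = {}" "?V \<subseteq> W \<union> Q"
    using x by (auto simp: region_def supp_def frac_set_def)
  have bV: "b \<in> ?V" using False by (simp add: supp_def)
  have "?V - T \<in> \<V>" if "T \<subseteq> insert b ?S" for T
  proof (cases "b \<in> T")
    case True
    show ?thesis
    proof (cases "b \<in> ?S")
      case True
      then show ?thesis using that cellsD(3)[OF cell] by (simp add: insert_absorb)
    next
      case nS: False
      \<comment> \<open>Here \<open>b\<close> is not a direction of the cube of \<open>x\<close>.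
        The rest of \<open>T\<close> is removed within that cube, and \<open>b\<close> afterwards by
        the assumption.\<close>
      have "?V - (T - {b}) \<in> \<V>" using that by (intro cellsD(3)[OF cell]) auto
      moreover have "b \<in> ?V - (T - {b})" "W \<subseteq> ?V - (T - {b})" "?V - (T - {b}) \<subseteq> W \<union> Q"
        using bV W that by auto
      ultimately have "?V - (T - {b}) - {b} \<in> \<V>" by (intro b[rule_format])
      moreover have "?V - (T - {b}) - {b} = ?V - T" using True by blast
      ultimately show ?thesis by simp
    qed
  next
    case False
    then show ?thesis using that by (intro cellsD(3)[OF cell]) auto
  qed
  then have cell': "(?V, insert b ?S) \<in> cells"
    using cellsD(1,2)[OF cell] bV unfolding cells_def by blast
  have "(supp (lower b s x), frac_set (lower b s x)) \<in> cells"
  proof (cases "s = 1")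
    case True
    have "supp (lower b s x) = ?V - {b}" "frac_set (lower b s x) = ?S - {b}"
      using True by (auto simp: supp_def frac_set_def lower_def)
    then show ?thesis using cells_face[OF cell', of "{b}" "?S - {b}"] by auto
  next
    case ns: False
    have "(1 - s) * x b \<le> 1 - s" using points_bounds[OF P, of b] s by (intro mult_left_le) auto
    then have "(1 - s) * x b < 1" using s False by auto
    then have "supp (lower b s x) = ?V" "frac_set (lower b s x) = insert b ?S"
      using ns False by (auto simp: supp_def frac_set_def lower_def)
    then show ?thesis using cell' by simp
  qed
  moreover have "0 \<le> lower b s x c \<and> lower b s x c \<le> 1" for c
    using points_bounds[OF P, of c] s by (auto simp: lower_def intro: mult_le_one)
  ultimately show ?thesis by (simp add: points_def)
qed

text \<open>Induction on the size of \<open>Q\<close>: \<open>peel\<close> supplies a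
  \<open>b\<close> along which the region retracts onto the region for \<open>Q - {b}\<close>. The
  same \<open>b\<close> is lowered at all times of the loop, so every stage of the homotopy is a
  loop. For empty \<open>Q\<close> only the point \<open>indicator W\<close> remains.\<close>

lemma loop_in_region_contractible:
  assumes "finite Q" and W: "W \<in> \<V>" "Q \<inter> W = {}"
    and p: "continuous_map (top_of_set {0..1::real}) space p"
    and loop: "p 0 = p 1"
    and reg: "\<And>t. t \<in> {0..1} \<Longrightarrow> \<exists>x\<in>region W Q. p t = code x"
  shows "homotopic_with (\<lambda>q. q 0 = q 1) (top_of_set {0..1}) space p (\<lambda>_. code (indicator W))"
  using assms
proof (induction "card Q" arbitrary: Q p)
  case 0
  then have "Q = {}" by simp
  have "p t = code (indicator W)" if t: "t \<in> {0..1}" for t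
  proof -
    obtain x where "x \<in> region W Q" "p t = code x" using "0.prems"(6)[OF t] by blast
    moreover from this have "x = indicator W"
      using \<open>Q = {}\<close> by (auto simp: fun_eq_iff region_def indicator_def)
    ultimately show ?thesis by simp
  qed
  then show ?case
    using "0.prems" by (intro homotopic_with_equal) auto
next
  case (Suc n)
  then have "Q \<noteq> {}" by auto
  obtain b where bQ: "b \<in> Q"
    and b: "\<forall>V\<in>\<V>. b \<in> V \<longrightarrow> W \<subseteq> V \<longrightarrow> V \<subseteq> W \<union> Q \<longrightarrow> V - {b} \<in> \<V>"
    using peel[OF W(1) \<open>finite Q\<close> \<open>Q \<noteq> {}\<close> Suc.prems(3)] by blast
  define F where "F t = decode (p t)" for t
  have pF: "p t = code (F t)" "F t \<in> region W Q" if "t \<in> {0..1}" for t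
    using Suc.prems(6)[OF that] by (auto simp: F_def)
  have bW: "b \<notin> W" using bQ Suc.prems(3) by blast
  have low: "lower b s x \<in> region W Q" if "x \<in> region W Q" "s \<in> {0..1}" for s x
    using lower_in_points[OF b that] that bW bQ by (auto simp: region_def lower_def)
  have low1: "lower b 1 x \<in> region W (Q - {b})" if "x \<in> region W Q" for x
    using lower_in_points[OF b that, of 1] that bW bQ by (auto simp: region_def lower_def)
  have contF: "continuous_map (top_of_set {0..1}) euclideanreal (\<lambda>t. F t c)" for c
    unfolding F_def
    using continuous_map_compose[OF Suc.prems(4) continuous_map_coordinate[of c]] by (simp add: o_def)
  define h where "h = (\<lambda>(s, t). code (lower b s (F t)))"
  have "continuous_map (prod_topology (top_of_set {0..1}) (top_of_set {0..1})) space
     (\<lambda>z. code (lower b (fst z) (F (snd z))))"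
  proof (rule continuous_map_into_region[OF \<open>finite Q\<close>])
    fix z :: "real \<times> real" assume "z \<in> topspace (prod_topology (top_of_set {0..1}) (top_of_set {0..1}))"
    then show "lower b (fst z) (F (snd z)) \<in> region W Q" using low pF by auto
  next
    fix c
    have *: "continuous_map (prod_topology (top_of_set {0..1::real}) (top_of_set {0..1::real})) euclideanreal (\<lambda>z. F (snd z) a)" for a
      using continuous_map_compose[OF continuous_map_snd contF[of a]] by (simp only: o_def)
    have **: "continuous_map (prod_topology (top_of_set {0..1::real}) (top_of_set {0..1::real})) euclideanreal fst"
      using continuous_map_fst continuous_map_into_fulltopology by blast
    show "continuous_map (prod_topology (top_of_set {0..1}) (top_of_set {0..1})) euclideanreal
          (\<lambda>z. lower b (fst z) (F (snd z)) c)"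
      using * ** unfolding lower_def
      by (cases "c = b") (auto intro!: continuous_intros)
  qed
  then have conth: "continuous_map (prod_topology (top_of_set {0..1}) (top_of_set {0..1})) space h"
    by (simp add: h_def case_prod_unfold)
  define q where "q t = code (lower b 1 (F t))" for t
  have F01: "F 0 = F 1" using Suc.prems(5) by (simp add: F_def)
  have pq: "homotopic_with (\<lambda>q. q 0 = q 1) (top_of_set {0..1}) space p q"
  proof (subst homotopic_with, force, intro exI conjI ballI)
    show "continuous_map (prod_topology (top_of_set {0..1}) (top_of_set {0..1})) space h" by (rule conth)
    show "h (0, t) = p t" if "t \<in> topspace (top_of_set {0..1})" for t
      using that pF by (simp add: h_def lower_def)
  qed (auto simp: h_def q_def F01)
  have "homotopic_with (\<lambda>q. q 0 = q 1) (top_of_set {0..1}) space q (\<lambda>_. code (indicator W))"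
  proof (rule Suc.hyps(1))
    show "n = card (Q - {b})" using Suc.hyps(2) bQ Suc.prems(1) by simp
    show "continuous_map (top_of_set {0..1}) space q"
      using pq homotopic_with_imp_continuous_maps by blast
  qed (use Suc.prems low1 pF in \<open>auto simp: q_def F01\<close>)
  with pq show ?case by (rule homotopic_with_trans)
qed

lemma loop_contractible:
  assumes p: "continuous_map (top_of_set {0..1::real}) space p" and loop: "p 0 = p 1"
  obtains W where "W \<in> \<V>"
    "homotopic_with (\<lambda>q. q 0 = q 1) (top_of_set {0..1}) space p (\<lambda>_. code (indicator W))"
proof -
  have "compactin space (p ` {0..1})"
    by (rule image_compactin[OF _ p]) (simp add: compactin_subtopology)
  define I where "I = {x \<in> points. code x \<in> p ` {0..1}}"
  define K where "K = (\<lambda>x. (supp x, frac_set x)) ` I"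
  have "finite K" unfolding K_def I_def by (rule compactin_finite_cells) fact
  \<comment> \<open>\<open>V - S\<close> is the smallest and \<open>V\<close> the largest vertex of
    a cube. The loop thus stays above the intersection of the finitely many smallest vertices and
    below the union of the largest ones.\<close>
  define cores where "cores = (\<lambda>(V, S). V - S) ` K"
  define tops where "tops = fst ` K"
  have K: "K \<subseteq> cells" using point_supp_frac(3) by (auto simp: K_def I_def)
  have coresV: "cores \<subseteq> \<V>" using K cellsD(3)[OF _ subset_refl] by (auto simp: cores_def)
  have topsV: "tops \<subseteq> \<V>" using K cellsD(4) by (auto simp: tops_def)
  define W where "W = \<Inter>cores"
  have im: "p t \<in> code ` points" if "t \<in> {0..1}" for t
    using p that topspace_space by (auto simp: continuous_map_def Pi_iff)
  then have "p 0 \<in> code ` points" by simp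
  then obtain x0 where "x0 \<in> points" "p 0 = code x0" by blast
  then have "x0 \<in> I" by (auto simp: I_def intro!: image_eqI[of _ _ 0])
  then have fin: "finite cores" "cores \<noteq> {}" using \<open>finite K\<close> by (auto simp: cores_def K_def)
  have W: "W \<in> \<V>"
    unfolding W_def using fin coresV
  proof (induction cores rule: finite_ne_induct)
    case (insert A B)
    then show ?case using inter by auto
  qed auto
  define Q where "Q = \<Union>tops - W"
  have "finite Q"
  proof -
    have "Q = (\<Union>V\<in>tops. V - W)" by (auto simp: Q_def)
    moreover have "finite tops" using \<open>finite K\<close> by (simp add: tops_def)
    moreover have "finite (V - W)" if "V \<in> tops" for V using finite_diff[OF _ W] topsV that by auto
    ultimately show ?thesis by (metis finite_UN_I)
  qed
  have "homotopic_with (\<lambda>q. q 0 = q 1) (top_of_set {0..1}) space p (\<lambda>_. code (indicator W))"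
  proof (rule loop_in_region_contractible[OF \<open>finite Q\<close> W _ p loop])
    fix t :: real assume t: "t \<in> {0..1}"
    then obtain x where x: "x \<in> points" "p t = code x" using im by blast
    with t have "x \<in> I" by (auto simp: I_def intro!: image_eqI[of _ _ t])
    then have "W \<subseteq> supp x - frac_set x" "supp x \<subseteq> W \<union> Q"
      by (auto simp: W_def cores_def K_def Q_def tops_def)
    then have "x \<in> region W Q"
      using x by (auto simp: region_def supp_def frac_set_def)
    then show "\<exists>x\<in>region W Q. p t = code x" using x by blast
  qed (auto simp: Q_def)
  with W show ?thesis using that by blast
qed

lemma indicator_in_points:
  assumes "D \<in> \<V>"
  shows "indicator D \<in> points"
proof -
  have "supp (indicator D :: 'b \<Rightarrow> real) = D" "frac_set (indicator D :: 'b \<Rightarrow> real) = {}"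
    by (auto simp: supp_def frac_set_def indicator_def)
  then show ?thesis using assms by (auto simp: points_def cells_def indicator_def)
qed

lemma path_connected_space_space: "path_connected_space space"
  unfolding path_connected_space_iff_path_component
proof (intro ballI)
  fix y z assume "y \<in> topspace space" "z \<in> topspace space"
  then obtain x x' where x: "x \<in> points" "y = code x" and x': "x' \<in> points" "z = code x'"
    by (auto simp: topspace_space)
  note c = point_supp_frac(3)[OF x(1)] and c' = point_supp_frac(3)[OF x'(1)]
  define W where "W = (supp x - frac_set x) \<inter> (supp x' - frac_set x')"
  define Q where "Q = (supp x - W) \<union> (supp x' - W)"
  have W: "W \<in> \<V>" unfolding W_def using inter cellsD(3)[OF c] cellsD(3)[OF c'] by blast
  have Q: "finite Q" "Q \<inter> W = {}"
    unfolding Q_def using finite_diff[OF cellsD(4)[OF c] W] finite_diff[OF cellsD(4)[OF c'] W] by auto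
  have "x \<in> region W Q" "x' \<in> region W Q"
    using x x' by (auto simp: region_def W_def Q_def supp_def frac_set_def)
  have "path_component_of space (code w) (code (indicator W))" if w: "w \<in> region W Q" for w
  proof -
    have "code w \<in> topspace space" using w by (simp add: region_def topspace_space)
    \<comment> \<open>The contraction of a constant loop traces a path from its value to
      \<open>indicator W\<close>, so no separate path construction is made.\<close>
    then have "homotopic_with (\<lambda>q. q 0 = q 1) (top_of_set {0..1::real}) space (\<lambda>_. code w) (\<lambda>_. code (indicator W))"
      using w by (intro loop_in_region_contractible[OF Q(1) W Q(2)]) auto
    then have "homotopic_with (\<lambda>_. True) (top_of_set {0..1::real}) space (\<lambda>_. code w) (\<lambda>_. code (indicator W))"
      by (rule homotopic_with_mono) simp
    moreover have "top_of_set {0..1::real} \<noteq> trivial_topology"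
      by (metis atLeastAtMost_iff empty_iff le_numeral_extra(3) topspace_discrete_topology topspace_euclidean_subtopology zero_le_one)
    ultimately show ?thesis by (simp add: homotopic_constant_maps)
  qed
  then show "path_component_of space y z"
    using \<open>x \<in> region W Q\<close> \<open>x' \<in> region W Q\<close> x x'
    by (meson path_component_of_sym path_component_of_trans)
qed

lemma simply_connected_space_space: "simply_connected_space space"
  unfolding simply_connected_space_def
proof (intro conjI allI impI)
  fix p assume p: "pathin space p \<and> p 0 = p 1"
  then obtain W where "W \<in> \<V>"
    "homotopic_with (\<lambda>q. q 0 = q 1) (top_of_set {0..1}) space p (\<lambda>_. code (indicator W))"
    using loop_contractible[of p] unfolding pathin_def by blast
  then show "\<exists>a\<in>topspace space. homotopic_with (\<lambda>q. q 0 = q 1) (top_of_set {0..1}) space p (\<lambda>_. a)"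
    using indicator_in_points unfolding topspace_space by blast
qed (rule path_connected_space_space)

section \<open>Gluing of the cubes along faces\<close>

lemma face_is_cell:
  assumes c: "(V, S) \<in> cells" and k: "k < card S" and e: "e \<in> {0, 1}"
  shows "\<exists>\<psi> \<sigma>. (card S - 1, \<psi>) \<in> complex \<and> cube_isometry (card S - 1) \<sigma> \<and>
        (\<forall>x\<in>cube (card S - 1). char_map V S (face_map k e x) = \<psi> (\<sigma> x))"
proof -
  have S: "finite S" by (rule cellsD(1)[OF c])
  have enum: "bij_betw (enum_of S) S {..<card S}" by (rule bij_betw_enum_of[OF S])
  then obtain b where b: "b \<in> S" "enum_of S b = k"
    using k by (metis (no_types, lifting) bij_betw_def imageE lessThan_iff)
  have enum_inj: "enum_of S c = enum_of S c' \<longleftrightarrow> c = c'" if "c \<in> S" "c' \<in> S" for c c'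
    using enum that by (auto simp: bij_betw_def inj_on_def)
  define S' where "S' = S - {b}"
  \<comment> \<open>On the face with coordinate 0 the element \<open>b\<close> is absent; on the
    opposite face it is present but no longer a direction.\<close>
  define V' where "V' = (if e = 0 then V - {b} else V)"
  have cell: "(V', S') \<in> cells"
    using cells_face[OF c, of "{b}" S'] cells_face[OF c, of "{}" S'] b by (auto simp: V'_def S'_def)
  have card: "card S' = card S - 1" using b S by (simp add: S'_def)
  \<comment> \<open>The numbering of \<open>S'\<close> inherited from \<open>S\<close>, with the gap
    at position \<open>k\<close> closed; \<open>face_map\<close> reopens this gap.\<close>
  define f where "f c = (if enum_of S c < k then enum_of S c else enum_of S c - 1)" for c
  have ne_k: "enum_of S c \<noteq> k" if "c \<in> S'" for c
    using that enum_inj[of c b] b by (auto simp: S'_def)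
  have "inj_on f S'"
  proof (rule inj_onI)
    fix c c' assume h: "c \<in> S'" "c' \<in> S'" "f c = f c'"
    then have "enum_of S c = enum_of S c'"
      using ne_k[of c] ne_k[of c'] by (auto simp: f_def split: if_splits)
    then show "c = c'" using enum_inj h by (auto simp: S'_def)
  qed
  moreover have "f ` S' \<subseteq> {..<card S'}"
  proof
    fix i assume "i \<in> f ` S'"
    then obtain c' where c': "c' \<in> S'" "i = f c'" by blast
    then have "enum_of S c' < card S" using enum_of_less[OF S] by (auto simp: S'_def)
    then show "i \<in> {..<card S'}" using c' ne_k[of c'] k by (auto simp: f_def card)
  qed
  ultimately have "bij_betw f S' {..<card S'}"
    by (simp add: bij_betw_def card_image card_subset_eq)
  moreover have "finite S'" using S by (simp add: S'_def)
  ultimately obtain \<sigma> where \<sigma>: "cube_isometry (card S') \<sigma>"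
      "\<And>u c. c \<in> S' \<Longrightarrow> \<sigma> u (enum_of S' c) = u (f c)"
    using enum_transition[of S' f] by blast
  have "point V S (face_map k e x) = point V' S' (\<sigma> x)" for x
  proof
    fix c
    consider "c = b" | "c \<in> S'" | "c \<notin> S" by (auto simp: S'_def)
    then show "point V S (face_map k e x) c = point V' S' (\<sigma> x) c"
    proof cases
      case 1
      then show ?thesis
        using e b cellsD(2)[OF c] by (auto simp: point_def S'_def V'_def face_map_def)
    next
      case 2
      then have "c \<in> S" by (simp add: S'_def)
      then show ?thesis
        using 2 ne_k[OF 2] \<sigma>(2)[OF 2] by (auto simp: point_def face_map_def f_def)
    next
      case 3
      then have "c \<noteq> b" "c \<notin> S'" using b by (auto simp: S'_def)
      then show ?thesis using 3 by (auto simp: point_def V'_def)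
    qed
  qed
  then have "\<forall>x\<in>cube (card S - 1). char_map V S (face_map k e x) = char_map V' S' (\<sigma> x)"
    by (simp add: char_map_def)
  moreover have "(card S - 1, char_map V' S') \<in> complex"
    unfolding complex_def card[symmetric] using cell by (rule rev_image_eqI) simp
  ultimately show ?thesis using \<sigma>(1) unfolding card by blast
qed

lemma cube_complex_space: "cube_complex space complex"
  unfolding cube_complex_def
proof (intro conjI)
  show "\<forall>(n, \<phi>)\<in>complex. \<phi> ` cube n \<subseteq> topspace space \<and> inj_on \<phi> (open_cube n)"
    using point_in_points inj_on_subset[OF inj_on_char_map open_cube_subset] cellsD(1)
    by (fastforce simp: complex_def topspace_space char_map_def)
  show "\<forall>y\<in>topspace space. \<exists>!c. c \<in> complex \<and> y \<in> snd c ` open_cube (fst c)"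
  proof
    fix y assume "y \<in> topspace space"
    then obtain x where x: "x \<in> points" "y = code x" by (auto simp: topspace_space)
    show "\<exists>!c. c \<in> complex \<and> y \<in> snd c ` open_cube (fst c)"
    proof (rule ex1I)
      let ?c = "(card (frac_set x), char_map (supp x) (frac_set x))"
      have "y = char_map (supp x) (frac_set x) (coords (frac_set x) x)"
        using point_supp_frac(1)[OF x(1)] x(2) by (simp add: char_map_def)
      then show "?c \<in> complex \<and> y \<in> snd ?c ` open_cube (fst ?c)"
        using point_supp_frac(2,3)[OF x(1)] by (auto simp: complex_def intro!: image_eqI[of _ _ "(supp x, frac_set x)"])
    next
      fix c assume "c \<in> complex \<and> y \<in> snd c ` open_cube (fst c)"
      then obtain V S u where c: "(V, S) \<in> cells" "c = (card S, char_map V S)"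
        and u: "u \<in> open_cube (card S)" "y = char_map V S u"
        by (auto simp: complex_def)
      then have "x = point V S u" using x(2) by (simp add: char_map_def)
      then have "supp x = V" "frac_set x = S" using supp_frac_point[OF c(1) u(1)] by simp_all
      then show "c = (card (frac_set x), char_map (supp x) (frac_set x))" using c by simp
    qed
  qed
  show "\<forall>(n, \<phi>)\<in>complex. \<forall>k<n. \<forall>e\<in>{0, 1}. \<exists>\<psi> \<sigma>. (n - 1, \<psi>) \<in> complex \<and> cube_isometry (n - 1) \<sigma> \<and>
      (\<forall>x\<in>cube (n - 1). \<phi> (face_map k e x) = \<psi> (\<sigma> x))"
  proof (rule ballI)
    fix z assume "z \<in> complex"
    then obtain V S where z: "z = (card S, char_map V S)" and c: "(V, S) \<in> cells"
      by (auto simp: complex_def)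
    show "case z of (n, \<phi>) \<Rightarrow> \<forall>k<n. \<forall>e\<in>{0, 1}. \<exists>\<psi> \<sigma>. (n - 1, \<psi>) \<in> complex \<and> cube_isometry (n - 1) \<sigma> \<and>
      (\<forall>x\<in>cube (n - 1). \<phi> (face_map k e x) = \<psi> (\<sigma> x))"
      unfolding z prod.case using face_is_cell[OF c] by blast
  qed
  show "\<forall>U\<subseteq>topspace space. openin space U \<longleftrightarrow> (\<forall>(n, \<phi>)\<in>complex.
      openin (subtopology (Euclidean_space n) (cube n)) {x \<in> cube n. \<phi> x \<in> U})"
    by (auto simp add: cube_topology topspace_space openin_space complex_def)
qed

section \<open>Links of vertices: cubes viewed from an arbitrary corner\<close>

definition spans :: "'b set \<Rightarrow> 'b set \<Rightarrow> bool" where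
  "spans D S \<longleftrightarrow> finite S \<and> (\<forall>T\<subseteq>S. sym_diff D T \<in> \<V>)"

lemma spansD: "spans D S \<Longrightarrow> T \<subseteq> S \<Longrightarrow> sym_diff D T \<in> \<V>"
  by (simp add: spans_def)

text \<open>The edge that leaves the corner \<open>D\<close> by adding \<open>b\<close> or, if
  \<open>b\<close> is already in \<open>D\<close>, by removing it. It has the same parametrisation
  and domain as \<open>corner_edge\<close>, so that link vertices can be compared as
  functions.\<close>

definition edge :: "'b set \<Rightarrow> 'b \<Rightarrow> real \<Rightarrow> 'x" where
  "edge D b = (\<lambda>t\<in>{0..1}. code (\<lambda>c. if c = b then (if b \<in> D then 1 - t else t) else indicator D c))"

lemma inj_edge: "inj (edge D)"
proof (rule injI)
  fix a b assume "edge D a = edge D b"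
  \<comment> \<open>At the midpoint of an edge its direction is the only coordinate different from 0
    and 1.\<close>
  then have "edge D a (1/2) = edge D b (1/2)" by simp
  then have eq: "(\<lambda>c. if c = a then (if a \<in> D then 1 - 1/2 else 1/2 :: real) else indicator D c) =
     (\<lambda>c. if c = b then (if b \<in> D then 1 - 1/2 else 1/2) else indicator D c)"
    by (simp only: edge_def restrict_apply code_eq_iff) simp
  show "a = b"
    using fun_cong[OF eq, of a] by (cases "a = b") (auto simp: indicator_def split: if_splits)
qed

text \<open>A point with all coordinates 0 or 1 is a corner of every closed cube containing it.
  Together with \<open>cell_if_spans\<close> this identifies the cubes at \<open>D\<close> with the
  sets \<open>S\<close> such that \<open>spans D S\<close>.\<close>

lemma cell_at_vertex:
  assumes c: "(V, S) \<in> cells" and eq: "char_map V S u = code (indicator D)"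
  shows "V = D \<union> S" "spans D S"
proof -
  have P: "point V S u b = indicator D b" for b using eq by (simp add: char_map_def)
  have "b \<in> D" if "b \<in> V - S" for b using P[of b] that by (simp add: point_def indicator_def split: if_splits)
  moreover have "b \<notin> D" if "b \<notin> V" for b
    using P[of b] that cellsD(2)[OF c] by (auto simp: point_def indicator_def split: if_splits)
  ultimately show V: "V = D \<union> S" using cellsD(2)[OF c] by blast
  have "sym_diff D T \<in> \<V>" if T: "T \<subseteq> S" for T
  proof -
    \<comment> \<open>Seen from the largest vertex \<open>V\<close>, one removes the directions that
      are neither in \<open>D\<close> nor flipped and those that are in \<open>D\<close> and
      flipped.\<close>
    have "sym_diff D T = V - ((S - D - T) \<union> (D \<inter> T))" using T unfolding V by blast
    also have "\<dots> \<in> \<V>" using T by (intro cellsD(3)[OF c]) blast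
    finally show ?thesis .
  qed
  then show "spans D S" using cellsD(1)[OF c] by (simp add: spans_def)
qed

lemma cell_if_spans:
  assumes "spans D S"
  shows "(D \<union> S, S) \<in> cells"
proof -
  have "D \<union> S - T \<in> \<V>" if "T \<subseteq> S" for T
  proof -
    have "D \<union> S - T = sym_diff D ((T \<inter> D) \<union> (S - D - T))" using that by blast
    also have "\<dots> \<in> \<V>" using that by (intro spansD[OF assms]) blast
    finally show ?thesis .
  qed
  then show ?thesis using assms by (auto simp: cells_def spans_def)
qed

lemma corner_edge_eq:
  assumes S: "finite S" and P: "point V S p = indicator D" and b: "b \<in> S"
  shows "corner_edge (char_map V S) p (enum_of S b) = edge D b"
proof -
  have p: "p (enum_of S c) = indicator D c" if "c \<in> S" for c
    using fun_cong[OF P, of c] that by (simp add: point_def)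
  have enum: "enum_of S c = enum_of S b \<longleftrightarrow> c = b" if "c \<in> S" for c
    using bij_betw_enum_of[OF S] b that by (auto simp: bij_betw_def inj_on_def)
  have "point V S (p(enum_of S b := if p (enum_of S b) = 0 then t else 1 - t)) =
    (\<lambda>c. if c = b then (if b \<in> D then 1 - t else t) else indicator D c)" for t
  proof
    fix c
    show "point V S (p(enum_of S b := if p (enum_of S b) = 0 then t else 1 - t)) c =
      (if c = b then (if b \<in> D then 1 - t else t) else indicator D c)"
      using p b enum[of c] fun_cong[OF P, of c] by (auto simp: point_def indicator_def split: if_splits)
  qed
  then show ?thesis by (simp add: corner_edge_def edge_def char_map_def)
qed

lemma corner_edges_eq:
  assumes S: "finite S" and P: "point V S p = indicator D"
  shows "corner_edges (card S, char_map V S, p) = edge D ` S"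
proof -
  have "{..<card S} = enum_of S ` S" using bij_betw_enum_of[OF S] by (simp add: bij_betw_def)
  then show ?thesis
    using corner_edge_eq[OF S P] by (simp add: corner_edges_def image_image cong: image_cong)
qed

lemma corners_atE:
  assumes "(n, \<phi>, p) \<in> corners_at complex (code (indicator D))"
  obtains S where "spans D S" "n = card S" "\<phi> = char_map (D \<union> S) S" "p = coords S (indicator D)"
    "point (D \<union> S) S p = indicator D"
proof -
  obtain V S where c: "(V, S) \<in> cells" "n = card S" "\<phi> = char_map V S"
    and p: "p \<in> cube_corners n" "\<phi> p = code (indicator D)"
    using assms by (auto simp: corners_at_def complex_def)
  have eq: "char_map V S p = code (indicator D)" using c p by simp
  note V = cell_at_vertex[OF c(1) eq]
  have P: "point V S p = indicator D" using eq by (simp add: char_map_def)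
  have "coords S (point V S p) = p"
    using p(1) c cube_corners_subset by (intro coords_point cellsD(1)[OF c(1)]) auto
  then show ?thesis using that[OF V(2)] c P V by simp
qed

lemma corners_atI:
  assumes "spans D S"
  shows "(card S, char_map (D \<union> S) S, coords S (indicator D)) \<in> corners_at complex (code (indicator D))"
    "point (D \<union> S) S (coords S (indicator D)) = indicator D"
proof -
  have S: "finite S" using assms by (simp add: spans_def)
  show P: "point (D \<union> S) S (coords S (indicator D)) = indicator D"
    by (rule point_coords[OF S]) (auto simp: indicator_def)
  have "coords S (indicator D) \<in> cube_corners (card S)"
    by (auto simp: cube_corners_iff coords_def indicator_def)
  then show "(card S, char_map (D \<union> S) S, coords S (indicator D)) \<in> corners_at complex (code (indicator D))"
    using cell_if_spans[OF assms] P by (auto simp: corners_at_def complex_def char_map_def)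
qed

text \<open>Through \<open>edge D\<close> the simplices of the link become the sets \<open>S\<close>
  with \<open>spans D S\<close>. The claim then reduces to injectivity of \<open>edge D\<close> and
  to the fact that \<open>D\<close> and \<open>S\<close> determine the cube and its corner.\<close>

lemma link_simplicial_complex: "link_simplicial complex (code (indicator D))"
  unfolding link_simplicial_def
proof (intro conjI)
  show "\<forall>(n, \<phi>, p)\<in>corners_at complex (code (indicator D)). inj_on (corner_edge \<phi> p) {..<n}"
  proof clarify
    fix n \<phi> p assume "(n, \<phi>, p) \<in> corners_at complex (code (indicator D))"
    then obtain S where S: "spans D S" "n = card S" "\<phi> = char_map (D \<union> S) S"
      "point (D \<union> S) S p = indicator D"
      by (rule corners_atE)
    then have fin: "finite S" by (simp add: spans_def)
    have n: "{..<n} = enum_of S ` S"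
      using bij_betw_enum_of[OF fin] S by (simp add: bij_betw_def)
    show "inj_on (corner_edge \<phi> p) {..<n}"
      unfolding n S(3) using corner_edge_eq[OF fin S(4)] inj_edge[of D]
      by (auto simp: inj_on_def)
  qed
  show "inj_on corner_edges (corners_at complex (code (indicator D)))"
  proof (rule inj_onI)
    fix c c' assume cc': "c \<in> corners_at complex (code (indicator D))"
      "c' \<in> corners_at complex (code (indicator D))" "corner_edges c = corner_edges c'"
    obtain n \<phi> p n' \<phi>' p' where c: "c = (n, \<phi>, p)" "c' = (n', \<phi>', p')"
      by (metis prod_cases3)
    have "(n, \<phi>, p) \<in> corners_at complex (code (indicator D))"
      "(n', \<phi>', p') \<in> corners_at complex (code (indicator D))"
      and eq: "corner_edges (n, \<phi>, p) = corner_edges (n', \<phi>', p')"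
      using cc' unfolding c by simp_all
    then obtain S S' where S: "spans D S" "n = card S" "\<phi> = char_map (D \<union> S) S"
      "p = coords S (indicator D)" "point (D \<union> S) S p = indicator D"
      and S': "spans D S'" "n' = card S'" "\<phi>' = char_map (D \<union> S') S'"
      "p' = coords S' (indicator D)" "point (D \<union> S') S' p' = indicator D"
      by (elim corners_atE)
    have "finite S" "finite S'" using S S' by (auto simp: spans_def)
    then have "edge D ` S = edge D ` S'"
      using eq corner_edges_eq S S' by metis
    then have "S = S'" using inj_edge by (simp add: inj_image_eq_iff)
    then show "c = c'" using S S' by (simp add: c)
  qed
qed

text \<open>A corner opposite to \<open>D\<close> of a cube of dimension at least 3 is a median of three of its neighbours.\<close>

lemma pairwise_spans:
  assumes D: "D \<in> \<V>" and B: "finite B" and pair: "\<And>a b. a \<in> B \<Longrightarrow> b \<in> B \<Longrightarrow> sym_diff D {a, b} \<in> \<V>"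
  shows "spans D B"
proof -
  have "sym_diff D T \<in> \<V>" if "T \<subseteq> B" for T
    using that
  proof (induction "card T" arbitrary: T rule: less_induct)
    case less
    have fin: "finite T" using less.prems B finite_subset by blast
    show ?case
    proof (cases "card T \<le> 2")
      case True
      show ?thesis
      proof (cases "T = {}")
        case False
        then obtain a where a: "a \<in> T" by blast
        have "card (T - {a}) \<le> 1" using a fin True by simp
        then obtain b where "T - {a} \<subseteq> {b}" using fin
          by (metis card_le_Suc0_iff_eq finite_Diff One_nat_def subsetI singleton_iff)
        with a have "T = {a} \<or> T = {a, b}" by auto
        then show ?thesis
        proof
          assume T: "T = {a}"
          then show ?thesis using pair[of a a] less.prems by simp
        next
          assume T: "T = {a, b}"
          have "a \<in> B" "b \<in> B" using less.prems unfolding T by simp_all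
          then show ?thesis unfolding T by (rule pair)
        qed
      qed (use D in simp)
    next
      case False
      then have "3 \<le> card T" by simp
      then obtain S where "S \<subseteq> T" "card S = 3" by (rule obtain_subset_with_card_n)
      then obtain a b c where abc: "a \<in> T" "b \<in> T" "c \<in> T" "a \<noteq> b" "b \<noteq> c" "a \<noteq> c"
        unfolding card_3_iff by auto
      have ih: "sym_diff D (T - {x}) \<in> \<V>" if "x \<in> T" for x
      proof (rule less.hyps)
        show "card (T - {x}) < card T" using fin that by (rule card_Diff1_less)
        show "T - {x} \<subseteq> B" using less.prems by blast
      qed
      have "sym_diff D T = (sym_diff D (T - {a}) \<inter> sym_diff D (T - {b})) \<union>
        (sym_diff D (T - {b}) \<inter> sym_diff D (T - {c})) \<union> (sym_diff D (T - {a}) \<inter> sym_diff D (T - {c}))"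
        using abc by (intro Set.set_eqI) auto
      also have "\<dots> \<in> \<V>" using abc by (intro median ih)
      finally show ?thesis .
    qed
  qed
  then show ?thesis using B by (simp add: spans_def)
qed

text \<open>A clique in the link becomes a finite set \<open>B\<close> of directions. Each link
  vertex gives an edge at \<open>D\<close> and each adjacent pair a square, and
  \<open>pairwise_spans\<close> fills in the whole cube.\<close>

lemma link_flag_complex:
  assumes D: "D \<in> \<V>"
  shows "link_flag complex (code (indicator D))"
  unfolding link_flag_def
proof (intro allI impI, elim conjE)
  fix E assume E: "E \<subseteq> link_vertices complex (code (indicator D))" "finite E"
    and pair: "\<forall>a\<in>E. \<forall>b\<in>E. a \<noteq> b \<longrightarrow> {a, b} \<in> corner_edges ` corners_at complex (code (indicator D))"
  have span: "spans D S" if img: "edge D ` S \<in> corner_edges ` corners_at complex (code (indicator D))" for S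
  proof -
    from img obtain c where "c \<in> corners_at complex (code (indicator D))" "edge D ` S = corner_edges c"
      by blast
    then obtain n \<phi> p where c: "(n, \<phi>, p) \<in> corners_at complex (code (indicator D))"
      "edge D ` S = corner_edges (n, \<phi>, p)"
      by (metis prod_cases3)
    from c(1) obtain S' where S': "spans D S'" "n = card S'" "\<phi> = char_map (D \<union> S') S'"
      "point (D \<union> S') S' p = indicator D" by (rule corners_atE)
    then have "finite S'" by (simp add: spans_def)
    then have "edge D ` S = edge D ` S'" using c(2) S' corner_edges_eq by simp
    then have "S = S'" using inj_edge by (simp add: inj_image_eq_iff)
    then show ?thesis using S' by simp
  qed
  define B where "B = edge D -` E"
  have "finite B" unfolding B_def using E(2) inj_edge by (rule finite_vimageI)
  have vert: "\<exists>b. e = edge D b \<and> sym_diff D {b} \<in> \<V>" if e: "e \<in> E" for e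
  proof -
    obtain \<phi> p where c: "(1, \<phi>, p) \<in> corners_at complex (code (indicator D))" "e = corner_edge \<phi> p 0"
      using e E(1) unfolding link_vertices_def by blast
    from c(1) obtain S where S: "spans D S" "1 = card S" "\<phi> = char_map (D \<union> S) S"
      "point (D \<union> S) S p = indicator D" by (rule corners_atE)
    then obtain b where b: "S = {b}" by (metis card_1_singletonE)
    have "enum_of S b = 0" using enum_of_less[of S b] b by simp
    then have "e = edge D b" using corner_edge_eq[of S "D \<union> S" p D b] b S c(2) by simp
    moreover have "sym_diff D {b} \<in> \<V>" using S(1) b by (auto simp: spans_def)
    ultimately show ?thesis by blast
  qed
  have EB: "E = edge D ` B" unfolding B_def using vert by blast
  have "spans D B"
  proof (rule pairwise_spans[OF D \<open>finite B\<close>])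
    fix a b assume a: "a \<in> B" and b: "b \<in> B"
    show "sym_diff D {a, b} \<in> \<V>"
    proof (cases "a = b")
      case True
      obtain c where "edge D a = edge D c" "sym_diff D {c} \<in> \<V>" using vert a by (auto simp: B_def)
      then have "a = c" "sym_diff D {c} \<in> \<V>" using inj_edge by (auto dest: injD)
      then show ?thesis using True by simp
    next
      case False
      then have "edge D a \<noteq> edge D b" using inj_edge by (auto dest: injD)
      then have "{edge D a, edge D b} \<in> corner_edges ` corners_at complex (code (indicator D))"
        using a b pair by (simp add: B_def)
      then have "spans D {a, b}" using span[of "{a, b}"] by simp
      then show ?thesis unfolding spans_def by blast
    qed
  qed
  from corners_atI[OF this] show "E \<in> corner_edges ` corners_at complex (code (indicator D))"
    using corner_edges_eq[OF \<open>finite B\<close>] EB by (metis image_eqI)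
qed

section \<open>The CAT(0) condition and local finiteness\<close>

lemma complex_verticesE:
  assumes "v \<in> complex_vertices complex"
  obtains D where "D \<in> \<V>" "v = code (indicator D)"
proof -
  obtain V S u where c: "(V, S) \<in> cells" "card S = 0" "v = char_map V S u"
    using assms by (auto simp: complex_vertices_def complex_def)
  then have "S = {}" using cellsD(1)[OF c(1)] by simp
  then have "point V S u = indicator V" by (auto simp: point_def indicator_def fun_eq_iff)
  then show ?thesis using that[of V] c cellsD(4)[OF c(1)] by (simp add: char_map_def)
qed

theorem CAT0_cube_complex_space: "CAT0_cube_complex space complex"
proof -
  obtain D where "D \<in> \<V>" using nonempty by blast
  then have "topspace space \<noteq> {}" using indicator_in_points unfolding topspace_space by blast
  then show ?thesis
    unfolding CAT0_cube_complex_def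
    using cube_complex_space simply_connected_space_space link_simplicial_complex link_flag_complex
    by (auto elim!: complex_verticesE)
qed

text \<open>A cube containing the vertex \<open>D\<close> is determined by its directions, and each
  direction leads to one of the finitely many neighbours of \<open>D\<close>.\<close>

theorem locally_finite_complex_space: "locally_finite_complex complex"
  unfolding locally_finite_complex_def
proof
  fix v assume "v \<in> complex_vertices complex"
  then obtain D where D: "D \<in> \<V>" "v = code (indicator D)" by (rule complex_verticesE)
  let ?N = "{b. sym_diff D {b} \<in> \<V>}"
  have "{(n, \<phi>) \<in> complex. v \<in> \<phi> ` cube n} \<subseteq> (\<lambda>S. (card S, char_map (D \<union> S) S)) ` Pow ?N"
  proof
    fix z assume "z \<in> {(n, \<phi>) \<in> complex. v \<in> \<phi> ` cube n}"
    then obtain V S u where c: "(V, S) \<in> cells" "z = (card S, char_map V S)" "v = char_map V S u"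
      by (auto simp: complex_def)
    have V: "V = D \<union> S" "spans D S" using cell_at_vertex[OF c(1)] c(3) D(2) by auto
    then have "S \<subseteq> ?N" unfolding spans_def by blast
    then show "z \<in> (\<lambda>S. (card S, char_map (D \<union> S) S)) ` Pow ?N" using c V by blast
  qed
  then show "finite {(n, \<phi>) \<in> complex. v \<in> \<phi> ` cube n}"
    by (rule finite_subset) (intro finite_imageI, simp only: finite_Pow_iff finite_neighbours[OF D(1)])
qed

section \<open>The induced action and its fixed points\<close>

definition push :: "('b \<Rightarrow> 'b) \<Rightarrow> 'x \<Rightarrow> 'x" where
  "push f = (\<lambda>y\<in>code ` points. code (decode y \<circ> inv_into UNIV f))"

lemma cells_image:
  assumes f: "bij f" and inv: "\<And>V. V \<in> \<V> \<Longrightarrow> f ` V \<in> \<V>" and c: "(V, S) \<in> cells"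
  shows "(f ` V, f ` S) \<in> cells"
proof -
  have "f ` V - T \<in> \<V>" if "T \<subseteq> f ` S" for T
  proof -
    from that obtain T' where "T' \<subseteq> S" "T = f ` T'" unfolding subset_image_iff by blast
    moreover have "f ` V - f ` T' = f ` (V - T')" using f by (simp add: bij_is_inj image_set_diff)
    ultimately show ?thesis using inv cellsD(3)[OF c] by simp
  qed
  then show ?thesis using cellsD(1,2)[OF c] by (auto simp: cells_def)
qed

lemma supp_frac_image:
  assumes f: "bij f"
  shows "supp (x \<circ> inv_into UNIV f) = f ` supp x" "frac_set (x \<circ> inv_into UNIV f) = f ` frac_set x"
  using f unfolding supp_def frac_set_def
  by (auto simp: bij_is_surj surj_f_inv_f bij_is_inj intro!: image_eqI[of _ _ "inv_into UNIV f _"])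

lemma points_image:
  assumes f: "bij f" and inv: "\<And>V. V \<in> \<V> \<Longrightarrow> f ` V \<in> \<V>" and x: "x \<in> points"
  shows "x \<circ> inv_into UNIV f \<in> points"
proof -
  have "(f ` supp x, f ` frac_set x) \<in> cells" using x by (intro cells_image[OF f inv]) (auto simp: points_def)
  then show ?thesis using x supp_frac_image[OF f, of x] by (simp add: points_def)
qed

lemma cubical_map_push:
  assumes f: "bij f" and inv: "\<And>V. V \<in> \<V> \<Longrightarrow> f ` V \<in> \<V>"
  shows "cubical_map complex (push f)"
  unfolding cubical_map_def
proof (rule ballI)
  fix z assume "z \<in> complex"
  then obtain V S where z: "z = (card S, char_map V S)" and c: "(V, S) \<in> cells"
    by (auto simp: complex_def)
  let ?g = "inv_into UNIV f"
  have S: "finite S" by (rule cellsD(1)[OF c])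
  have inj: "inj f" using f by (rule bij_is_inj)
  have card: "card (f ` S) = card S" using inj by (simp add: card_image inj_on_subset)
  have "bij_betw ?g (f ` S) S" using f by (simp add: bij_betw_def inj_on_inv_into bij_is_surj inj image_image)
  then have "bij_betw (enum_of S \<circ> ?g) (f ` S) {..<card (f ` S)}"
    unfolding card using bij_betw_enum_of[OF S] by (rule bij_betw_trans)
  then obtain \<sigma> where \<sigma>: "cube_isometry (card S) \<sigma>"
      "\<And>u b. b \<in> f ` S \<Longrightarrow> \<sigma> u (enum_of (f ` S) b) = u ((enum_of S \<circ> ?g) b)"
    using enum_transition[of "f ` S"] S card by (metis finite_imageI)
  have gin: "b \<in> f ` A \<longleftrightarrow> ?g b \<in> A" for b A
    using f by (metis bij_def inj_image_mem_iff surj_f_inv_f)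
  have "push f (char_map V S x) = char_map (f ` V) (f ` S) (\<sigma> x)" if "x \<in> cube (card S)" for x
  proof -
    have "push f (char_map V S x) = code (point V S x \<circ> ?g)"
      using point_in_points[OF c that] by (simp add: push_def char_map_def)
    moreover have "point V S x \<circ> ?g = point (f ` V) (f ` S) (\<sigma> x)"
      using \<sigma>(2) gin by (auto simp: fun_eq_iff point_def)
    ultimately show ?thesis by (simp add: char_map_def)
  qed
  moreover have "(card S, char_map (f ` V) (f ` S)) \<in> complex"
    using cells_image[OF f inv c] by (force simp: complex_def card[symmetric])
  ultimately show "case z of (n, \<phi>) \<Rightarrow> \<exists>\<psi> \<sigma>. (n, \<psi>) \<in> complex \<and> cube_isometry n \<sigma> \<and>
     (\<forall>x\<in>cube n. push f (\<phi> x) = \<psi> (\<sigma> x))"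
    unfolding z prod.case using \<sigma>(1) by blast
qed

lemma push_comp:
  assumes f: "bij f" and g: "bij g" and inv: "\<And>V. V \<in> \<V> \<Longrightarrow> g ` V \<in> \<V>"
  shows "push (f \<circ> g) = compose (code ` points) (push f) (push g)"
  using points_image[OF g inv] f g
  by (auto simp: fun_eq_iff push_def compose_def o_inv_distrib o_assoc)

lemma push_id: "push id = (\<lambda>y\<in>code ` points. y)"
  by (auto simp: push_def fun_eq_iff)

text \<open>Vertices are moved as sets, so the action respects inclusion between them. It therefore
  fixes not only the cube around a fixed point but also the largest vertex of that cube, without any
  subdivision.\<close>

theorem FW_LocFin_imp_invariant_vertex:
  fixes G (structure)
  assumes G: "group G" and FW: "FW_LocFin_on TYPE('x) G"
    and bij: "\<And>g. g \<in> carrier G \<Longrightarrow> bij (a g)"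
    and inv: "\<And>g V. g \<in> carrier G \<Longrightarrow> V \<in> \<V> \<Longrightarrow> a g ` V \<in> \<V>"
    and one: "a \<one> = id" and mult: "\<And>g h. g \<in> carrier G \<Longrightarrow> h \<in> carrier G \<Longrightarrow> a (g \<otimes> h) = a g \<circ> a h"
  obtains D where "D \<in> \<V>" "\<And>g. g \<in> carrier G \<Longrightarrow> a g ` D = D"
proof -
  interpret group G by (rule G)
  let ?X = "code ` points"
  have comp: "push (a (g \<otimes> h)) = compose ?X (push (a g)) (push (a h))"
    if "g \<in> carrier G" "h \<in> carrier G" for g h
    using mult that push_comp bij inv by simp
  have closed: "push (a g) ` ?X \<subseteq> ?X" if "g \<in> carrier G" for g
    using points_image bij inv that by (auto simp: push_def)
  have Bij: "push (a g) \<in> Bij ?X" if g: "g \<in> carrier G" for g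
    unfolding Bij_def
  proof
    have one': "push (a (inv g)) (push (a g) y) = y" "push (a g) (push (a (inv g)) y) = y"
      if "y \<in> ?X" for y
      using fun_cong[OF comp[of "inv g" g], of y] fun_cong[OF comp[of g "inv g"], of y] g that
      by (simp_all add: one push_id compose_eq)
    show "push (a g) \<in> {f. bij_betw f ?X ?X}"
    proof (clarify, rule bij_betw_byWitness[where f' = "push (a (inv g))"])
      show "\<forall>y\<in>?X. push (a (inv g)) (push (a g) y) = y" "\<forall>y\<in>?X. push (a g) (push (a (inv g)) y) = y"
        using one' by blast+
    qed (use closed g in auto)
    show "push (a g) \<in> extensional ?X" by (simp add: push_def)
  qed
  have "group_action G (topspace space) (\<lambda>g. push (a g))"
    unfolding group_action_def group_hom_def group_hom_axioms_def topspace_space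
    using G group_BijGroup comp Bij
    by (auto simp: hom_def BijGroup_def)
  moreover have "\<forall>g\<in>carrier G. cubical_map complex (push (a g))"
    using cubical_map_push bij inv by blast
  ultimately have "\<exists>y\<in>topspace space. \<forall>g\<in>carrier G. push (a g) y = y"
    using FW[unfolded FW_LocFin_on_def, rule_format, of space complex "\<lambda>g. push (a g)"]
      CAT0_cube_complex_space locally_finite_complex_space by simp
  then obtain y where y: "y \<in> ?X" "\<And>g. g \<in> carrier G \<Longrightarrow> push (a g) y = y"
    unfolding topspace_space by blast
  then obtain x where x: "x \<in> points" "y = code x" by blast
  have "a g ` supp x = supp x" if "g \<in> carrier G" for g
  proof -
    have "x \<circ> inv_into UNIV (a g) = x" using y(2)[OF that] x by (simp add: push_def)
    then show ?thesis using supp_frac_image(1)[OF bij[OF that], of x] by simp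
  qed
  moreover have "supp x \<in> \<V>" using point_supp_frac(3)[OF x(1)] cellsD(4) by blast
  ultimately show ?thesis using that by blast
qed

end


section \<open>The Neretin group as a group of permutations of balls\<close>

text \<open>Only finite unions are allowed, which keeps the type countable, as the coding of points
  by reals requires. The empty union is a legitimate ball without children.\<close>

datatype ball = Cone "nat list" | Merge "ball fset"

instance ball :: countable
  by countable_datatype

primrec height :: "ball \<Rightarrow> nat" where
  "height (Cone v) = 0"
| "height (Merge S) = Suc (Max (insert 0 (fset (height |`| S))))"

text \<open>Decreases strictly from a ball to each child. Cones can be subdivided forever, so the
  values are unbounded below and allow no well-founded induction; the rank serves to pick a topmost
  ball in a finite set.\<close>

definition rank :: "ball \<Rightarrow> int" where
  "rank b = (case b of Cone v \<Rightarrow> - int (length v) | Merge S \<Rightarrow> int (height b))"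

lemma height_less: "b |\<in>| S \<Longrightarrow> height b < height (Merge S)"
  by (auto simp: less_Suc_eq_le intro!: Max_ge)

locale neretin =
  fixes d r :: nat
  assumes d: "d \<ge> 2"
begin

section \<open>The tree and the isomorphisms of its cofinite forests\<close>

abbreviation T :: "nat list set" where "T \<equiv> tree_verts d r"
abbreviation T' :: "nat list set" where "T' \<equiv> T - {[]}"
abbreviation forest :: "nat list set \<Rightarrow> nat list set" where "forest \<equiv> cofinite_forest d r"
abbreviation adm :: "nat list set \<Rightarrow> bool" where "adm \<equiv> admissible d r"

text \<open>
  \<open>T'\<close> leaves out the root, because it is the only vertex that may fail to have \<open>d\<close> children.
\<close>

definition kids :: "nat list \<Rightarrow> nat list set" where "kids v = {w \<in> T. \<exists>i. w = v @ [i]}"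

lemma Nil_in_T: "[] \<in> T"
  by (simp add: tree_verts_def)

lemma snoc_in_T: "v @ [i] \<in> T \<longleftrightarrow> v \<in> T \<and> i < (if v = [] then r else d)"
  by (cases v) (auto simp: tree_verts_def)

lemma kids_eq: "v \<in> T' \<Longrightarrow> kids v = (\<lambda>i. v @ [i]) ` {..<d}"
  by (auto simp: kids_def snoc_in_T)

lemma kids_nonempty: "v \<in> T' \<Longrightarrow> kids v \<noteq> {}"
  using d by (auto simp: kids_eq lessThan_empty_iff)

lemma finite_kids: "finite (kids v)"
proof -
  have "kids v \<subseteq> (\<lambda>i. v @ [i]) ` {..<max d r}" by (auto simp: kids_def snoc_in_T split: if_splits)
  then show ?thesis by (rule finite_subset) simp
qed

lemma kids_subset: "kids v \<subseteq> T'"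
  by (auto simp: kids_def)

lemma kids_disjoint: "w \<in> kids u \<Longrightarrow> w \<in> kids v \<Longrightarrow> u = v"
  by (auto simp: kids_def)

lemma kids_asym: "w \<in> kids v \<Longrightarrow> v \<notin> kids w"
  by (auto simp: kids_def dest: arg_cong[of _ _ length])

lemma finite_T_length: "finite {v \<in> T. length v < N}"
proof (rule finite_subset)
  show "{v \<in> T. length v < N} \<subseteq> {xs. set xs \<subseteq> {..<max d r} \<and> length xs \<le> N}"
  proof
    fix v assume v: "v \<in> {v \<in> T. length v < N}"
    then show "v \<in> {xs. set xs \<subseteq> {..<max d r} \<and> length xs \<le> N}"
      by (cases v) (auto simp: tree_verts_def less_max_iff_disj)
  qed
  show "finite {xs. set xs \<subseteq> {..<max d r} \<and> length xs \<le> N}"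
    by (rule finite_lists_length_le) simp
qed

text \<open>Every finite set of vertices lies in such a truncation, so finitely many exceptions can
  always be absorbed into an admissible set.\<close>

lemma admissible_length: "adm {v \<in> T. length v < N}"
  using finite_T_length by (auto simp: admissible_def snoc_in_T)

lemma forest_kids:
  assumes "adm F" "v \<in> forest F"
  shows "kids v \<subseteq> forest F"
  using assms by (auto simp: kids_def admissible_def cofinite_forest_def)

lemma Nil_in_admissible:
  assumes "adm F" "F \<noteq> {}"
  shows "[] \<in> F"
proof -
  have "v \<in> F \<Longrightarrow> [] \<in> F" for v
  proof (induction v rule: rev_induct)
    case (snoc a v)
    then show ?case using assms(1) by (auto simp: admissible_def)
  qed
  then show ?thesis using assms(2) by blast
qed

text \<open>Describes the roots by the relation \<open>kids\<close> inside the forest alone, with no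
  separate case for empty \<open>F\<close>, so that maps respecting \<open>kids\<close> carry roots
  to roots.\<close>

lemma forest_roots_eq:
  assumes F: "adm F"
  shows "forest_roots d r F = {v \<in> forest F. \<forall>u\<in>forest F. v \<notin> kids u}"
proof -
  have "((F = {} \<and> v = []) \<or> (\<exists>u\<in>F. \<exists>a. v = u @ [a])) \<longleftrightarrow> (\<forall>u\<in>forest F. v \<notin> kids u)"
    if v: "v \<in> forest F" for v
  proof (cases v rule: rev_cases)
    case Nil
    then have "F = {}" using v Nil_in_admissible[OF F] by (auto simp: cofinite_forest_def)
    then show ?thesis using Nil by (auto simp: kids_def)
  next
    case (snoc u a)
    then have "u \<in> T" "v \<in> T" using v by (auto simp: cofinite_forest_def snoc_in_T)
    then show ?thesis using snoc by (auto simp: kids_def cofinite_forest_def)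
  qed
  then show ?thesis unfolding forest_roots_def by blast
qed

lemma tree_adj_iff: "u \<in> T \<Longrightarrow> v \<in> T \<Longrightarrow> tree_adj u v \<longleftrightarrow> v \<in> kids u \<or> u \<in> kids v"
  by (auto simp: tree_adj_def kids_def)

text \<open>Replaces undirected adjacency and the condition on roots by compatibility with
  \<open>kids\<close>. The orientation of an edge is recovered by induction away from the roots: a
  root goes to a root, and afterwards the parent of each image is already accounted for.\<close>

lemma forest_iso_iff:
  assumes F: "adm F" and F': "adm F'"
  shows "forest_iso d r F F' \<psi> \<longleftrightarrow>
    bij_betw \<psi> (forest F) (forest F') \<and> (\<forall>v\<in>forest F. \<psi> ` kids v = kids (\<psi> v))" (is "?L \<longleftrightarrow> ?R")
proof
  assume L: ?L
  then have bij: "bij_betw \<psi> (forest F) (forest F')"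
    and adj: "\<And>u v. u \<in> forest F \<Longrightarrow> v \<in> forest F \<Longrightarrow> tree_adj (\<psi> u) (\<psi> v) \<longleftrightarrow> tree_adj u v"
    and roots: "bij_betw \<psi> (forest_roots d r F) (forest_roots d r F')"
    by (auto simp: forest_iso_def)
  have T: "v \<in> T" if "v \<in> forest A" for v A using that by (simp add: cofinite_forest_def)
  have im: "\<psi> v \<in> forest F'" if "v \<in> forest F" for v using bij that by (auto dest: bij_betwE)
  have inj: "u = v" if "\<psi> u = \<psi> v" "u \<in> forest F" "v \<in> forest F" for u v
    using bij that by (auto simp: bij_betw_def inj_on_def)
  have kid: "\<psi> w \<in> kids (\<psi> v)" if "v \<in> forest F" "w \<in> kids v" for v w
    using that
  proof (induction v arbitrary: w rule: rev_induct)
    case Nil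
    then have w: "w \<in> forest F" using forest_kids[OF F] by blast
    have "[] \<in> forest_roots d r F"
      using Nil by (auto simp: forest_roots_eq[OF F] kids_def)
    then have "\<psi> [] \<in> forest_roots d r F'" using roots by (auto dest: bij_betwE)
    then have "\<psi> [] \<notin> kids (\<psi> w)" using im[OF w] by (auto simp: forest_roots_eq[OF F'])
    moreover have "tree_adj (\<psi> []) (\<psi> w)"
      using adj[OF Nil(1) w] Nil T w by (auto simp: tree_adj_def kids_def)
    ultimately show ?case using tree_adj_iff T im w Nil by metis
  next
    case (snoc a u)
    let ?v = "u @ [a]"
    have w: "w \<in> forest F" using snoc.prems forest_kids[OF F] by blast
    have "tree_adj (\<psi> ?v) (\<psi> w)"
      using adj[OF snoc.prems(1) w] snoc.prems T w by (auto simp: tree_adj_def kids_def)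
    then have *: "\<psi> w \<in> kids (\<psi> ?v) \<or> \<psi> ?v \<in> kids (\<psi> w)"
      using tree_adj_iff T im w snoc.prems(1) by metis
    \<comment> \<open>The parent of the image of \<open>u @ [a]\<close> is the image of
      \<open>u\<close> if \<open>u\<close> lies in the forest; otherwise \<open>u @ [a]\<close> is a
      root and so is its image. In neither case can the image of \<open>w\<close> be that
      parent.\<close>
    have "\<psi> ?v \<notin> kids (\<psi> w)"
    proof (cases "u \<in> forest F")
      case True
      have v: "?v \<in> kids u" using snoc.prems(1) T by (auto simp: kids_def)
      then have "\<psi> ?v \<in> kids (\<psi> u)" using snoc.IH[OF True] by blast
      moreover have "\<psi> u \<noteq> \<psi> w"
        using inj[OF _ True w] snoc.prems(2) by (auto simp: kids_def)
      ultimately show ?thesis using kids_disjoint by blast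
    next
      case False
      have "?v \<notin> kids x" if "x \<in> forest F" for x
        using that False by (auto simp: kids_def)
      then have "?v \<in> forest_roots d r F"
        using snoc.prems(1) by (auto simp: forest_roots_eq[OF F])
      then have "\<psi> ?v \<in> forest_roots d r F'" using roots by (auto dest: bij_betwE)
      then show ?thesis using im[OF w] by (auto simp: forest_roots_eq[OF F'])
    qed
    with * show ?case by blast
  qed
  have "\<psi> ` kids v = kids (\<psi> v)" if v: "v \<in> forest F" for v
  proof
    show "\<psi> ` kids v \<subseteq> kids (\<psi> v)" using kid[OF v] by blast
    show "kids (\<psi> v) \<subseteq> \<psi> ` kids v"
    proof
      fix y assume y: "y \<in> kids (\<psi> v)"
      then have "y \<in> forest F'" using forest_kids[OF F' im[OF v]] by blast
      then obtain w where w: "w \<in> forest F" "y = \<psi> w" using bij by (metis bij_betw_imp_surj_on imageE)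
      have "tree_adj (\<psi> v) (\<psi> w)" using y w by (auto simp: tree_adj_def kids_def)
      then have "w \<in> kids v \<or> v \<in> kids w" using adj[OF v w(1)] tree_adj_iff[OF T[OF v] T[OF w(1)]] by simp
      moreover have "v \<notin> kids w"
      proof
        assume "v \<in> kids w"
        then have "\<psi> v \<in> kids (\<psi> w)" by (rule kid[OF w(1)])
        then show False using y w kids_asym by blast
      qed
      ultimately show "y \<in> \<psi> ` kids v" using w by blast
    qed
  qed
  with bij show ?R by blast
next
  assume R: ?R
  then have bij: "bij_betw \<psi> (forest F) (forest F')"
    and kid: "\<And>v. v \<in> forest F \<Longrightarrow> \<psi> ` kids v = kids (\<psi> v)" by auto
  have T: "v \<in> T" if "v \<in> forest A" for v A using that by (simp add: cofinite_forest_def)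
  have im: "\<psi> v \<in> forest F'" if "v \<in> forest F" for v using bij that by (auto dest: bij_betwE)
  have inj: "u = v" if "\<psi> u = \<psi> v" "u \<in> forest F" "v \<in> forest F" for u v
    using bij that by (auto simp: bij_betw_def inj_on_def)
  have kid_iff: "\<psi> w \<in> kids (\<psi> v) \<longleftrightarrow> w \<in> kids v" if v: "v \<in> forest F" and w: "w \<in> forest F" for v w
    unfolding kid[OF v, symmetric] using inj[OF _ w] forest_kids[OF F v] by blast
  have "\<psi> ` forest_roots d r F = forest_roots d r F'"
  proof (intro Set.set_eqI iffI)
    fix y assume "y \<in> \<psi> ` forest_roots d r F"
    then obtain v where v: "v \<in> forest F" "\<forall>u\<in>forest F. v \<notin> kids u" "y = \<psi> v"
      by (auto simp: forest_roots_eq[OF F])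
    have "\<psi> v \<notin> kids x" if "x \<in> forest F'" for x
      using that bij kid_iff[OF _ v(1)] v(2) by (metis bij_betw_imp_surj_on imageE)
    then show "y \<in> forest_roots d r F'" using im v by (auto simp: forest_roots_eq[OF F'])
  next
    fix y assume "y \<in> forest_roots d r F'"
    then have y: "y \<in> forest F'" "\<forall>u\<in>forest F'. y \<notin> kids u" by (auto simp: forest_roots_eq[OF F'])
    then obtain v where v: "v \<in> forest F" "y = \<psi> v" using bij by (metis bij_betw_imp_surj_on imageE)
    then have "v \<notin> kids u" if "u \<in> forest F" for u using kid_iff[OF that v(1)] y im[OF that] by blast
    then show "y \<in> \<psi> ` forest_roots d r F" using v by (auto simp: forest_roots_eq[OF F])
  qed
  moreover have "forest_roots d r F \<subseteq> forest F" by (auto simp: forest_roots_def)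
  ultimately have "bij_betw \<psi> (forest_roots d r F) (forest_roots d r F')"
    using bij by (auto simp: bij_betw_def inj_on_subset)
  moreover have "tree_adj (\<psi> u) (\<psi> v) \<longleftrightarrow> tree_adj u v" if "u \<in> forest F" "v \<in> forest F" for u v
    using that kid_iff tree_adj_iff[OF T T, of u F v F] tree_adj_iff[OF T[OF im] T[OF im], of u v] by simp
  ultimately show ?L using bij by (auto simp: forest_iso_def)
qed

lemma forest_iso_cong:
  assumes F: "adm F" and F': "adm F'" and eq: "\<And>v. v \<in> forest F \<Longrightarrow> \<psi> v = \<phi> v"
  shows "forest_iso d r F F' \<psi> \<longleftrightarrow> forest_iso d r F F' \<phi>"
proof -
  have "\<psi> ` kids v = \<phi> ` kids v" if "v \<in> forest F" for v
    using forest_kids[OF F that] eq by (auto intro!: image_cong)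
  then show ?thesis
    unfolding forest_iso_iff[OF F F'] using eq bij_betw_cong[of "forest F" \<psi> \<phi>] by simp
qed

text \<open>The new target is forced by the image of \<open>forest E\<close>. That image is closed
  under \<open>kids\<close>, so its complement is closed under parents; the complement exceeds
  \<open>F'\<close> by at most the image of \<open>E - F\<close>, so it is finite.\<close>

lemma forest_iso_restrict:
  assumes F: "adm F" "adm F'" and iso: "forest_iso d r F F' \<psi>" and E: "adm E" "F \<subseteq> E"
  shows "adm (T - \<psi> ` forest E)" "F' \<subseteq> T - \<psi> ` forest E" "forest_iso d r E (T - \<psi> ` forest E) \<psi>"
proof -
  let ?E' = "T - \<psi> ` forest E"
  have bij: "bij_betw \<psi> (forest F) (forest F')" and kid: "\<And>v. v \<in> forest F \<Longrightarrow> \<psi> ` kids v = kids (\<psi> v)"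
    using iso by (auto simp: forest_iso_iff[OF F])
  have sub: "forest E \<subseteq> forest F" using E(2) by (auto simp: cofinite_forest_def)
  have im: "\<psi> ` forest E \<subseteq> forest F'" using bij sub by (auto simp: bij_betw_def)
  show F'E': "F' \<subseteq> ?E'" using im F(2) by (auto simp: cofinite_forest_def admissible_def)
  have "?E' \<subseteq> F' \<union> \<psi> ` (E - F)"
  proof
    fix y assume y: "y \<in> ?E'"
    show "y \<in> F' \<union> \<psi> ` (E - F)"
    proof (cases "y \<in> F'")
      case False
      then have "y \<in> forest F'" using y by (simp add: cofinite_forest_def)
      then obtain v where "v \<in> forest F" "y = \<psi> v" using bij by (metis bij_betw_imp_surj_on imageE)
      then show ?thesis using y by (auto simp: cofinite_forest_def)
    qed simp
  qed
  then have fin: "finite ?E'" using F E by (auto simp: admissible_def intro: finite_subset)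
  have "u \<in> ?E'" if "u @ [a] \<in> ?E'" for u a
  proof (rule ccontr)
    assume "u \<notin> ?E'"
    moreover have "u \<in> T" using that by (simp add: snoc_in_T)
    ultimately obtain w where w: "w \<in> forest E" "u = \<psi> w" by blast
    have "u @ [a] \<in> kids u" using that by (auto simp: kids_def)
    moreover have "\<psi> ` kids w = kids u" unfolding w(2) by (rule kid) (use w(1) sub in blast)
    ultimately have "u @ [a] \<in> \<psi> ` kids w" by simp
    moreover have "\<psi> ` kids w \<subseteq> \<psi> ` forest E" by (rule image_mono[OF forest_kids[OF E(1) w(1)]])
    ultimately show False using that by blast
  qed
  then show adm: "adm ?E'" using fin unfolding admissible_def by blast
  have "forest ?E' = \<psi> ` forest E" using im by (auto simp: cofinite_forest_def)
  then have "bij_betw \<psi> (forest E) (forest ?E')"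
    using bij sub by (auto simp: bij_betw_def inj_on_subset)
  then show "forest_iso d r E ?E' \<psi>" unfolding forest_iso_iff[OF E(1) adm] using kid sub by blast
qed

lemma forest_iso_inverse:
  assumes F: "adm F" "adm F'" and iso: "forest_iso d r F F' \<psi>"
  shows "forest_iso d r F' F (inv_into (forest F) \<psi>)"
proof -
  let ?\<phi> = "inv_into (forest F) \<psi>"
  have bij: "bij_betw \<psi> (forest F) (forest F')" and kid: "\<And>v. v \<in> forest F \<Longrightarrow> \<psi> ` kids v = kids (\<psi> v)"
    using iso by (auto simp: forest_iso_iff[OF F])
  have "?\<phi> ` kids y = kids (?\<phi> y)" if y: "y \<in> forest F'" for y
  proof -
    obtain v where v: "v \<in> forest F" "y = \<psi> v" using y bij by (metis bij_betw_imp_surj_on imageE)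
    have "?\<phi> ` kids y = (?\<phi> \<circ> \<psi>) ` kids v" by (simp add: v(2) kid[OF v(1), symmetric] image_comp)
    also have "\<dots> = id ` kids v"
      using forest_kids[OF F(1) v(1)] bij_betw_inv_into_left[OF bij] by (intro image_cong) auto
    finally show ?thesis using bij_betw_inv_into_left[OF bij v(1)] v(2) by simp
  qed
  then show ?thesis unfolding forest_iso_iff[OF F(2,1)] using bij_betw_inv_into[OF bij] by blast
qed

lemma length_bound: "finite X \<Longrightarrow> \<exists>N. \<forall>v\<in>X. length v < (N::nat)" for X :: "nat list set"
  by (metis finite_imageI finite_nat_set_iff_bounded imageI)

lemma finite_preimage:
  assumes "adm F" "adm F'" "forest_iso d r F F' \<psi>" "finite X"
  shows "finite {v \<in> forest F. \<psi> v \<in> X}"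
proof -
  have "inj_on \<psi> (forest F)" using assms by (auto simp: forest_iso_def bij_betw_def)
  then have "finite (\<psi> -` X \<inter> forest F)" using assms(4) by (rule finite_vimage_IntI[rotated])
  moreover have "\<psi> -` X \<inter> forest F = {v \<in> forest F. \<psi> v \<in> X}" by blast
  ultimately show ?thesis by simp
qed

text \<open>Truncating the source beyond the preimages of \<open>X\<close> pushes \<open>X\<close>
  out of the image. This makes the target of one representative large enough to contain the source
  of another.\<close>

lemma enlarge_representative:
  assumes F: "adm F" "adm F'" and iso: "forest_iso d r F F' \<psi>" and X: "finite X" "X \<subseteq> T"
  obtains E E' where "adm E" "adm E'" "F \<subseteq> E" "F' \<subseteq> E'" "X \<subseteq> E'" "forest_iso d r E E' \<psi>"
proof -
  have "finite F" using F by (simp add: admissible_def)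
  then obtain N where N: "\<forall>v\<in>F \<union> {v \<in> forest F. \<psi> v \<in> X}. length v < N"
    using length_bound[of "F \<union> {v \<in> forest F. \<psi> v \<in> X}"] finite_preimage[OF F iso X(1)] by auto
  let ?E = "{v \<in> T. length v < N}"
  have FE: "F \<subseteq> ?E" using N F by (auto simp: admissible_def)
  have "X \<subseteq> T - \<psi> ` forest ?E" using N X(2) by (auto simp: cofinite_forest_def)
  with forest_iso_restrict[OF F iso admissible_length FE] show ?thesis
    using that[OF admissible_length _ FE] by blast
qed

lemma triples_iff:
  "(\<psi>, F, F') \<in> aa_triples d r \<longleftrightarrow> adm F \<and> adm F' \<and> forest_iso d r F F' \<psi> \<and> \<psi> \<in> extensional (forest F)"
  by (simp add: aa_triples_def)

lemma triples_restrict: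
  assumes "adm F" "adm F'" "forest_iso d r F F' \<psi>"
  shows "(restrict \<psi> (forest F), F, F') \<in> aa_triples d r"
  using assms forest_iso_cong[of F F' "restrict \<psi> (forest F)" \<psi>] by (simp add: triples_iff)

lemma aa_relI:
  assumes "(\<psi>1, F1, F1') \<in> aa_triples d r" "(\<psi>2, F2, F2') \<in> aa_triples d r" "adm E" "adm E'"
    "F1 \<subseteq> E" "F2 \<subseteq> E" "F1' \<subseteq> E'" "F2' \<subseteq> E'" "forest_iso d r E E' \<psi>1" "forest_iso d r E E' \<psi>2"
    "\<And>v. v \<in> forest E \<Longrightarrow> \<psi>1 v = \<psi>2 v"
  shows "((\<psi>1, F1, F1'), (\<psi>2, F2, F2')) \<in> aa_rel d r"
  unfolding aa_rel_def using assms by blast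

text \<open>Equivalence is equality up to finitely many vertices: beyond a common truncation both
  maps agree, hence have the same image there and the same target.\<close>

lemma aa_rel_iff:
  "((\<psi>1, F1, F1'), (\<psi>2, F2, F2')) \<in> aa_rel d r \<longleftrightarrow>
   (\<psi>1, F1, F1') \<in> aa_triples d r \<and> (\<psi>2, F2, F2') \<in> aa_triples d r \<and> finite {v \<in> T'. \<psi>1 v \<noteq> \<psi>2 v}"
  (is "?L \<longleftrightarrow> ?R")
proof
  assume ?L
  then obtain E where E: "adm E" "\<forall>v\<in>forest E. \<psi>1 v = \<psi>2 v"
    and *: "(\<psi>1, F1, F1') \<in> aa_triples d r" "(\<psi>2, F2, F2') \<in> aa_triples d r"
    unfolding aa_rel_def by blast
  have "{v \<in> T'. \<psi>1 v \<noteq> \<psi>2 v} \<subseteq> E" using E by (auto simp: cofinite_forest_def)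
  then have "finite {v \<in> T'. \<psi>1 v \<noteq> \<psi>2 v}" 
    by (rule finite_subset) (use E in \<open>simp add: admissible_def\<close>)
  then show ?R using * by blast
next
  assume R: ?R
  then have F1: "adm F1" "adm F1'" "forest_iso d r F1 F1' \<psi>1"
    and F2: "adm F2" "adm F2'" "forest_iso d r F2 F2' \<psi>2" by (auto simp: triples_iff)
  \<comment> \<open>The root is added because agreement is known only on \<open>T'\<close>; the
    truncation has to delete it.\<close>
  have "finite (F1 \<union> F2 \<union> {[]} \<union> {v \<in> T'. \<psi>1 v \<noteq> \<psi>2 v})" using F1 F2 R by (auto simp: admissible_def)
  from length_bound[OF this]
  obtain N where N: "\<forall>v\<in>F1 \<union> F2 \<union> {[]} \<union> {v \<in> T'. \<psi>1 v \<noteq> \<psi>2 v}. length v < N" ..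
  let ?E = "{v \<in> T. length v < N}"
  have sub: "F1 \<subseteq> ?E" "F2 \<subseteq> ?E" using N F1 F2 by (auto simp: admissible_def)
  have eq: "\<psi>1 v = \<psi>2 v" if "v \<in> forest ?E" for v
    using that N Nil_in_T by (cases "v = []") (auto simp: cofinite_forest_def)
  then have "\<psi>1 ` forest ?E = \<psi>2 ` forest ?E" by (intro image_cong) auto
  then have "adm (T - \<psi>1 ` forest ?E)" "F1' \<subseteq> T - \<psi>1 ` forest ?E" "F2' \<subseteq> T - \<psi>1 ` forest ?E"
    "forest_iso d r ?E (T - \<psi>1 ` forest ?E) \<psi>1" "forest_iso d r ?E (T - \<psi>1 ` forest ?E) \<psi>2"
    using forest_iso_restrict[OF F1 admissible_length sub(1)] forest_iso_restrict[OF F2 admissible_length sub(2)]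
    by simp_all
  with eq sub R admissible_length[of N] show ?L
    by (intro aa_relI[where E = ?E and E' = "T - \<psi>1 ` forest ?E"]) simp_all
qed

section \<open>Children of balls, and maps compatible with them\<close>

definition ch :: "ball \<Rightarrow> ball set" where
  "ch b = (case b of Cone v \<Rightarrow> Cone ` kids v | Merge S \<Rightarrow> fset S)"

text \<open>
  Normal terms are reduced: a cone is never written as the union of its children. This makes
  \<open>ch\<close> injective.
\<close>

inductive normal :: "ball \<Rightarrow> bool" where
  Cone: "v \<in> T' \<Longrightarrow> normal (Cone v)"
| Merge: "(\<And>b. b \<in> fset S \<Longrightarrow> normal b) \<Longrightarrow> (\<And>w. w \<in> T' \<Longrightarrow> fset S \<noteq> Cone ` kids w) \<Longrightarrow> normal (Merge S)"

lemma ch_simps [simp]: "ch (Cone v) = Cone ` kids v" "ch (Merge S) = fset S"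
  by (simp_all add: ch_def)

lemma normal_Cone [simp]: "normal (Cone v) \<longleftrightarrow> v \<in> T'"
  by (subst normal.simps) auto

lemma inj_Cone: "inj Cone"
  by (rule injI) simp

lemma finite_ch: "finite (ch b)"
  by (cases b) (simp_all add: finite_kids)

lemma normal_ch: "normal b \<Longrightarrow> c \<in> ch b \<Longrightarrow> normal c"
  by (erule normal.cases) (auto dest: subsetD[OF kids_subset])

lemma ch_inj:
  assumes "normal b" "normal b'" "ch b = ch b'"
  shows "b = b'"
  using assms(1)
proof cases
  case b: (Cone v)
  show ?thesis
    using assms(2)
  proof cases
    case b': (Cone w)
    have "kids v = kids w" using assms(3) b b' inj_Cone by (simp add: inj_image_eq_iff)
    then show ?thesis using kids_nonempty[OF b(2)] kids_disjoint b b' by blast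
  next
    case (Merge S)
    then show ?thesis using assms(3) b(1) Merge(3)[OF b(2)] by simp
  qed
next
  case b: (Merge S)
  show ?thesis
    using assms(2)
  proof cases
    case (Cone w)
    then show ?thesis using assms(3) b(1) b(3)[OF Cone(2)] by simp
  next
    case (Merge S')
    then show ?thesis using assms(3) b by (simp add: fset_inject)
  qed
qed

lemma rank_ch: "c \<in> ch b \<Longrightarrow> rank c < rank b"
proof (cases b)
  case (Merge S)
  assume "c \<in> ch b"
  then have "c |\<in>| S" using Merge by simp
  then have "height c < height b" using height_less Merge by simp
  then show ?thesis using Merge by (cases c) (auto simp: rank_def)
qed (auto simp: rank_def kids_def)

text \<open>The reducing constructor: it returns the cone when \<open>S\<close> consists of the
  children of a cone, and the formal union otherwise. By \<open>ch_inj\<close> the choice is unique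
  when it exists.\<close>

definition merge :: "ball set \<Rightarrow> ball" where
  "merge S = (SOME b. normal b \<and> ch b = S)"

lemma merge:
  assumes "finite S" "\<And>b. b \<in> S \<Longrightarrow> normal b"
  shows "normal (merge S)" "ch (merge S) = S"
proof -
  have "\<exists>b. normal b \<and> ch b = S"
  proof (cases "\<exists>w\<in>T'. S = Cone ` kids w")
    case True
    then obtain w where "w \<in> T'" "S = Cone ` kids w" by blast
    then show ?thesis by (intro exI[of _ "Cone w"]) simp
  next
    case False
    have S: "fset (Abs_fset S) = S" using assms(1) by (simp add: Abs_fset_inverse)
    have "normal (Merge (Abs_fset S))" by (rule normal.Merge) (use S assms False in auto)
    then show ?thesis using S by (intro exI[of _ "Merge (Abs_fset S)"]) simp
  qed
  then have "normal (merge S) \<and> ch (merge S) = S" unfolding merge_def by (rule someI_ex)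
  then show "normal (merge S)" "ch (merge S) = S" by blast+
qed

text \<open>Terms that are not normal are fixed, so that a ball map is determined on the whole type
  and invertible ones are permutations of the index set of coordinates.\<close>

definition ball_map :: "(ball \<Rightarrow> ball) \<Rightarrow> bool" where
  "ball_map a \<longleftrightarrow> (\<forall>b. normal b \<longrightarrow> normal (a b) \<and> ch (a b) = a ` ch b) \<and> (\<forall>b. \<not> normal b \<longrightarrow> a b = b)"

definition follows :: "(ball \<Rightarrow> ball) \<Rightarrow> (nat list \<Rightarrow> nat list) \<Rightarrow> bool" where
  "follows a \<psi> \<longleftrightarrow> finite {v \<in> T'. a (Cone v) \<noteq> Cone (\<psi> v)}"

lemma ball_mapD:
  assumes "ball_map a"
  shows "normal b \<Longrightarrow> normal (a b)" "normal b \<Longrightarrow> ch (a b) = a ` ch b" "\<not> normal b \<Longrightarrow> a b = b"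
  using assms by (auto simp: ball_map_def)

text \<open>Agreement on all children forces agreement on the ball, by \<open>ch_inj\<close>. If two
  maps differ on finitely many cones only, a deepest such cone would contradict this; induction then
  climbs through the formal unions.\<close>

lemma ball_map_unique:
  assumes a: "ball_map a" and a': "ball_map a'"
    and fin: "finite {v \<in> T'. a (Cone v) \<noteq> a' (Cone v)}" (is "finite ?X")
  shows "a = a'"
proof -
  have agree: "a b = a' b" if "normal b" "\<And>c. c \<in> ch b \<Longrightarrow> a c = a' c" for b
  proof (rule ch_inj)
    show "normal (a b)" "normal (a' b)" using ball_mapD(1) a a' that(1) by auto
    show "ch (a b) = ch (a' b)"
      using ball_mapD(2)[OF a that(1)] ball_mapD(2)[OF a' that(1)] that(2) by auto
  qed
  have X: "?X = {}"
  proof (rule ccontr)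
    assume "?X \<noteq> {}"
    with fin have "Max (length ` ?X) \<in> length ` ?X" by simp
    then obtain v where v: "v \<in> ?X" "length v = Max (length ` ?X)" by force
    have max: "length w \<le> length v" if "w \<in> ?X" for w
      unfolding v(2) using fin that by (intro Max_ge) auto
    have "a (Cone v) = a' (Cone v)"
    proof (rule agree)
      fix c assume "c \<in> ch (Cone v)"
      then obtain w where w: "c = Cone w" "w \<in> kids v" by auto
      then have "length w > length v" by (auto simp: kids_def)
      then have "w \<notin> ?X" using max by fastforce
      then show "a c = a' c" using w kids_subset by auto
    qed (use v in simp)
    then show False using v by simp
  qed
  have "a b = a' b" if "normal b" for b
    using that
  proof (induction rule: normal.induct)
    case (Merge S)
    show ?case
    proof (rule agree)
      show "normal (Merge S)" using Merge by (intro normal.Merge) blast+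
    qed (use Merge in simp)
  qed (use X in auto)
  then have "a b = a' b" for b
    using ball_mapD(3)[OF a, of b] ball_mapD(3)[OF a', of b] by (cases "normal b") auto
  then show ?thesis by (rule ext)
qed

primrec extend :: "(nat list \<Rightarrow> ball) \<Rightarrow> ball \<Rightarrow> ball" where
  "extend f (Cone v) = f v"
| "extend f (Merge S) = merge (fset (extend f |`| S))"

lemma ball_map_extend:
  assumes f: "\<And>v. v \<in> T' \<Longrightarrow> normal (f v)" "\<And>v. v \<in> T' \<Longrightarrow> ch (f v) = f ` kids v"
  shows "ball_map (\<lambda>b. if normal b then extend f b else b)"
proof -
  have "normal (extend f b) \<and> ch (extend f b) = extend f ` ch b" if "normal b" for b
    using that
  proof (induction rule: normal.induct)
    case (Cone v)
    then show ?case using f by (simp add: image_image)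
  next
    case (Merge S)
    then have "finite (extend f ` fset S)" "\<And>b. b \<in> extend f ` fset S \<Longrightarrow> normal b" by auto
    from merge[OF this] show ?case by simp
  qed
  then show ?thesis using normal_ch by (auto simp: ball_map_def intro!: image_cong)
qed

text \<open>Deep in the tree the values are cones prescribed by \<open>\<psi>\<close>. Moving
  towards the root one level at a time, the image of a cone is defined as the reduced union of the
  images of its children.\<close>

lemma follows_exists:
  assumes t: "(\<psi>, F, F') \<in> aa_triples d r"
  shows "\<exists>a. ball_map a \<and> follows a \<psi>"
proof -
  have F: "adm F" "adm F'" and iso: "forest_iso d r F F' \<psi>" using t by (auto simp: triples_iff)
  then have bij: "bij_betw \<psi> (forest F) (forest F')" and kid: "\<And>v. v \<in> forest F \<Longrightarrow> \<psi> ` kids v = kids (\<psi> v)"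
    by (auto simp: forest_iso_iff[OF F])
  \<comment> \<open>From level \<open>N\<close> on, vertices must lie in the domain of
    \<open>\<psi>\<close> and must not be sent to the root, which has no cone.\<close>
  have "finite (F \<union> {v \<in> forest F. \<psi> v \<in> {[]}})"
    using finite_preimage[OF F iso, of "{[]}"] F(1) by (simp add: admissible_def)
  from length_bound[OF this] obtain N
    where N: "\<forall>v\<in>F \<union> {v \<in> forest F. \<psi> v \<in> {[]}}. length v < N" ..
  have far: "\<psi> v \<in> T'" "\<psi> ` kids v = kids (\<psi> v)" if "v \<in> T'" "length v \<ge> N" for v
  proof -
    have "v \<notin> F" using that(2) N by (metis UnI1 linorder_not_le)
    then have v: "v \<in> forest F" using that by (simp add: cofinite_forest_def)
    then show "\<psi> ` kids v = kids (\<psi> v)" by (rule kid)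
    have "\<psi> v \<in> forest F'" using bij v by (auto dest: bij_betwE)
    moreover have "\<psi> v \<noteq> []" 
    proof
      assume "\<psi> v = []"
      with v have "length v < N" using N by blast
      with that(2) show False by simp
    qed
    ultimately show "\<psi> v \<in> T'" by (simp add: cofinite_forest_def)
  qed
  define P where "P k f \<longleftrightarrow> (\<forall>v\<in>T'. normal (f v)) \<and> (\<forall>v\<in>T'. length v \<ge> N \<longrightarrow> f v = Cone (\<psi> v)) \<and>
     (\<forall>v\<in>T'. length v + k \<ge> N \<longrightarrow> ch (f v) = f ` kids v)" for k f
  have "\<exists>f. P k f" for k
  proof (induction k)
    case 0
    \<comment> \<open>The levels still to be treated carry the childless ball as a placeholder, of
      which only normality is used.\<close>
    define f where "f v = (if v \<in> T' \<and> length v \<ge> N then Cone (\<psi> v) else merge {})" for v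
    have "normal (f v)" for v using far merge[of "{}"] by (auto simp: f_def)
    moreover have "ch (f v) = f ` kids v" if v: "v \<in> T'" "length v \<ge> N" for v
    proof -
      have "f w = Cone (\<psi> w)" if "w \<in> kids v" for w
        using that v kids_subset by (auto simp: f_def kids_def)
      then have "f ` kids v = Cone ` \<psi> ` kids v" by (auto simp: image_image)
      then show ?thesis using v far by (simp add: f_def)
    qed
    moreover have "f v = Cone (\<psi> v)" if "v \<in> T'" "length v \<ge> N" for v
      using that by (simp add: f_def)
    ultimately have "P 0 f" by (simp add: P_def)
    then show ?case by blast
  next
    case (Suc k)
    then obtain f where "P k f" ..
    then have f: "normal (f v)" "length v \<ge> N \<Longrightarrow> f v = Cone (\<psi> v)"
      "length v + k \<ge> N \<Longrightarrow> ch (f v) = f ` kids v" if "v \<in> T'" for v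
      using that unfolding P_def by blast+
    \<comment> \<open>Only the level \<open>N - Suc k\<close> is overwritten, if there is one. The
      children of its vertices keep their values, and after \<open>N\<close> rounds no level is
      left.\<close>
    define g where "g v = (if length v + Suc k = N then merge (f ` kids v) else f v)" for v
    have m: "normal (merge (f ` kids v))" "ch (merge (f ` kids v)) = f ` kids v" for v
      using merge[of "f ` kids v"] f(1) kids_subset finite_kids by auto
    have gk: "g ` kids v = f ` kids v" if "length v + Suc k \<ge> N" for v
      using that by (intro image_cong) (auto simp: g_def kids_def)
    have "ch (g v) = g ` kids v" if v: "v \<in> T'" "length v + Suc k \<ge> N" for v
      unfolding gk[OF v(2)] using v f(3) m by (auto simp: g_def)
    moreover have "normal (g v)" if "v \<in> T'" for v using f(1) m that by (simp add: g_def)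
    moreover have "g v = Cone (\<psi> v)" if "v \<in> T'" "length v \<ge> N" for v
      using f(2) that by (simp add: g_def)
    ultimately have "P (Suc k) g" by (simp add: P_def)
    then show ?case by blast
  qed
  then obtain f where "P N f" by blast
  then have f: "normal (f v)" "length v \<ge> N \<Longrightarrow> f v = Cone (\<psi> v)" "ch (f v) = f ` kids v" if "v \<in> T'" for v
    using that by (simp_all add: P_def)
  let ?a = "\<lambda>b. if normal b then extend f b else b"
  have "{v \<in> T'. ?a (Cone v) \<noteq> Cone (\<psi> v)} \<subseteq> {v \<in> T. length v < N}"
    using f(2) by force
  then have "follows ?a \<psi>" unfolding follows_def using finite_T_length by (rule finite_subset)
  moreover have "ball_map ?a" using f(1,3) by (rule ball_map_extend)
  ultimately show ?thesis by blast
qed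

section \<open>Almost automorphisms as permutations of balls\<close>

definition cls :: "(ball \<Rightarrow> ball) \<Rightarrow> aa_triple set" where
  "cls a = {(\<psi>, F, F') \<in> aa_triples d r. follows a \<psi>}"

text \<open>\<open>cls\<close> will be a bijection from these maps onto the group; it turns the
  product of classes, defined through matching representatives, into composition of
  functions.\<close>

definition acts :: "(ball \<Rightarrow> ball) set" where
  "acts = {a. ball_map a \<and> cls a \<noteq> {}}"

lemma actsI: "ball_map a \<Longrightarrow> (\<psi>, F, F') \<in> aa_triples d r \<Longrightarrow> follows a \<psi> \<Longrightarrow> a \<in> acts"
  by (auto simp: acts_def cls_def)

lemma actsE:
  assumes "a \<in> acts"
  obtains \<psi> F F' where "ball_map a" "(\<psi>, F, F') \<in> aa_triples d r" "follows a \<psi>" "(\<psi>, F, F') \<in> cls a"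
proof -
  from assms obtain t where a: "ball_map a" and t: "t \<in> cls a" by (auto simp: acts_def)
  obtain \<psi> F F' where "t = (\<psi>, F, F')" by (rule prod_cases3)
  with that a t show ?thesis by (auto simp: cls_def)
qed

lemma follows_agree:
  assumes "follows a \<psi>"
  shows "follows a \<phi> \<longleftrightarrow> finite {v \<in> T'. \<psi> v \<noteq> \<phi> v}"
proof
  assume "follows a \<phi>"
  then have "finite ({v \<in> T'. a (Cone v) \<noteq> Cone (\<psi> v)} \<union> {v \<in> T'. a (Cone v) \<noteq> Cone (\<phi> v)})"
    using assms by (simp add: follows_def)
  then show "finite {v \<in> T'. \<psi> v \<noteq> \<phi> v}" by (rule finite_subset[rotated]) auto
next
  assume "finite {v \<in> T'. \<psi> v \<noteq> \<phi> v}"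
  then have "finite ({v \<in> T'. a (Cone v) \<noteq> Cone (\<psi> v)} \<union> {v \<in> T'. \<psi> v \<noteq> \<phi> v})"
    using assms by (simp add: follows_def)
  then show "follows a \<phi>" unfolding follows_def by (rule finite_subset[rotated]) auto
qed

lemma class_eq_cls:
  assumes "(\<psi>, F, F') \<in> aa_triples d r" "follows a \<psi>"
  shows "aa_rel d r `` {(\<psi>, F, F')} = cls a"
  using assms by (auto simp: cls_def aa_rel_iff follows_agree[OF assms(2)])

lemma follows_unique:
  assumes "ball_map a" "ball_map a'" "follows a \<psi>" "follows a' \<psi>"
  shows "a = a'"
proof (rule ball_map_unique[OF assms(1,2)])
  have "finite ({v \<in> T'. a (Cone v) \<noteq> Cone (\<psi> v)} \<union> {v \<in> T'. a' (Cone v) \<noteq> Cone (\<psi> v)})"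
    using assms(3,4) by (simp add: follows_def)
  then show "finite {v \<in> T'. a (Cone v) \<noteq> a' (Cone v)}" by (rule finite_subset[rotated]) auto
qed

lemma inj_on_cls: "inj_on cls acts"
proof (rule inj_onI)
  fix a a' assume a: "a \<in> acts" and a': "a' \<in> acts" and eq: "cls a = cls a'"
  from a obtain \<psi> F F' where *: "ball_map a" "follows a \<psi>" "(\<psi>, F, F') \<in> cls a" by (rule actsE)
  then have "follows a' \<psi>" unfolding eq by (simp add: cls_def)
  moreover have "ball_map a'" using a' by (simp add: acts_def)
  ultimately show "a = a'" using * follows_unique by blast
qed

lemma carrier_neretin: "carrier (neretin_group d r) = cls ` acts"
proof (intro Set.set_eqI iffI)
  fix A assume "A \<in> carrier (neretin_group d r)"
  then obtain t where t: "t \<in> aa_triples d r" "A = aa_rel d r `` {t}"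
    by (auto simp: neretin_group_def quotient_def)
  obtain \<psi> F F' where tt: "t = (\<psi>, F, F')" by (rule prod_cases3)
  obtain a where a: "ball_map a" "follows a \<psi>" using follows_exists t tt by blast
  have "A = cls a" using class_eq_cls a t tt by simp
  moreover have "a \<in> acts" using actsI a t tt by blast
  ultimately show "A \<in> cls ` acts" by blast
next
  fix A assume "A \<in> cls ` acts"
  then obtain a where a: "a \<in> acts" "A = cls a" by blast
  from a(1) obtain \<psi> F F' where *: "(\<psi>, F, F') \<in> aa_triples d r" "follows a \<psi>" by (rule actsE)
  then have "A = aa_rel d r `` {(\<psi>, F, F')}" using class_eq_cls a(2) by simp
  then show "A \<in> carrier (neretin_group d r)"
    using * by (auto simp: neretin_group_def quotient_def)
qed

section \<open>Composition, inverses and the group law\<close>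

lemma ball_map_comp: "ball_map a \<Longrightarrow> ball_map b \<Longrightarrow> ball_map (a \<circ> b)"
  by (auto simp: ball_map_def image_comp)

lemma ball_map_id: "ball_map id"
  by (simp add: ball_map_def)

lemma follows_comp:
  assumes t2: "(\<psi>2, F2, F3) \<in> aa_triples d r" and t1: "(\<psi>1, F1, F2) \<in> aa_triples d r"
    and a: "follows a \<psi>2" and b: "follows b \<psi>1"
  shows "(compose (forest F1) \<psi>2 \<psi>1, F1, F3) \<in> aa_triples d r"
    "follows (a \<circ> b) (compose (forest F1) \<psi>2 \<psi>1)"
proof -
  have F: "adm F1" "adm F2" "adm F3" and iso: "forest_iso d r F1 F2 \<psi>1" "forest_iso d r F2 F3 \<psi>2"
    using t1 t2 by (auto simp: triples_iff)
  have bij: "bij_betw \<psi>1 (forest F1) (forest F2)" "bij_betw \<psi>2 (forest F2) (forest F3)"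
    and kid: "\<And>v. v \<in> forest F1 \<Longrightarrow> \<psi>1 ` kids v = kids (\<psi>1 v)"
      "\<And>v. v \<in> forest F2 \<Longrightarrow> \<psi>2 ` kids v = kids (\<psi>2 v)"
    using iso F by (auto simp: forest_iso_iff)
  have im: "\<psi>1 v \<in> forest F2" if "v \<in> forest F1" for v using bij(1) that by (auto dest: bij_betwE)
  have "(\<psi>2 \<circ> \<psi>1) ` kids v = kids ((\<psi>2 \<circ> \<psi>1) v)" if "v \<in> forest F1" for v
    using kid(1)[OF that] kid(2)[OF im[OF that]] by (simp only: image_comp[symmetric] o_apply)
  then have "forest_iso d r F1 F3 (\<psi>2 \<circ> \<psi>1)"
    unfolding forest_iso_iff[OF F(1,3)] using bij_betw_trans[OF bij] by blast
  then have "forest_iso d r F1 F3 (compose (forest F1) \<psi>2 \<psi>1)"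
    using forest_iso_cong[OF F(1,3), of "compose (forest F1) \<psi>2 \<psi>1" "\<psi>2 \<circ> \<psi>1"] by (simp add: compose_eq)
  then show "(compose (forest F1) \<psi>2 \<psi>1, F1, F3) \<in> aa_triples d r"
    using F by (simp add: triples_iff)
  let ?X = "{v \<in> T'. a (Cone v) \<noteq> Cone (\<psi>2 v)}"
  \<comment> \<open>An exception for the composite is a vertex outside the domain, an exception for
    \<open>b\<close>, or a vertex whose image is the root or an exception for \<open>a\<close>. The
    last kind is finite because \<open>\<psi>1\<close> is injective on its forest.\<close>
  have "{v \<in> T'. (a \<circ> b) (Cone v) \<noteq> Cone (compose (forest F1) \<psi>2 \<psi>1 v)} \<subseteq>
    F1 \<union> {v \<in> T'. b (Cone v) \<noteq> Cone (\<psi>1 v)} \<union> {v \<in> forest F1. \<psi>1 v \<in> insert [] ?X}" (is "_ \<subseteq> ?Y")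
  proof
    fix v assume v: "v \<in> {v \<in> T'. (a \<circ> b) (Cone v) \<noteq> Cone (compose (forest F1) \<psi>2 \<psi>1 v)}"
    show "v \<in> ?Y"
    proof (rule ccontr)
      assume nY: "v \<notin> ?Y"
      then have v1: "v \<in> forest F1" "b (Cone v) = Cone (\<psi>1 v)" using v by (auto simp: cofinite_forest_def)
      then have "\<psi>1 v \<in> T'" using nY im[OF v1(1)] by (auto simp: cofinite_forest_def)
      then have "a (Cone (\<psi>1 v)) = Cone (\<psi>2 (\<psi>1 v))" using nY v1 by blast
      then show False using v v1 by (simp add: compose_eq)
    qed
  qed
  moreover have "finite ?Y"
  proof -
    have "finite (insert [] ?X)" using a by (simp add: follows_def)
    then have "finite {v \<in> forest F1. \<psi>1 v \<in> insert [] ?X}" by (rule finite_preimage[OF F(1,2) iso(1)])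
    then show ?thesis using F(1) b unfolding follows_def admissible_def by blast
  qed
  ultimately show "follows (a \<circ> b) (compose (forest F1) \<psi>2 \<psi>1)"
    unfolding follows_def by (rule finite_subset)
qed

lemma follows_restrict:
  assumes "follows a \<psi>" "finite F"
  shows "follows a (restrict \<psi> (forest F))"
proof -
  have "{v \<in> T'. \<psi> v \<noteq> restrict \<psi> (forest F) v} \<subseteq> F" by (auto simp: cofinite_forest_def)
  then have "finite {v \<in> T'. \<psi> v \<noteq> restrict \<psi> (forest F) v}" using assms(2) by (rule finite_subset)
  then show ?thesis using follows_agree[OF assms(1)] by simp
qed

text \<open>The target of a representative of \<open>b\<close> is enlarged until it contains the
  source of one of \<open>a\<close>; the latter is then restricted to the complement of that
  target.\<close>

lemma composable_representatives:
  assumes "a \<in> acts" "b \<in> acts"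
  obtains \<psi>1 \<psi>2 F1 F2 F3 where "(\<psi>2, F2, F3) \<in> cls a" "(\<psi>1, F1, F2) \<in> cls b"
proof -
  from assms(1) obtain \<psi>2 E E' where 2: "(\<psi>2, E, E') \<in> aa_triples d r" "follows a \<psi>2" by (rule actsE)
  from assms(2) obtain \<psi>1 G G' where 1: "(\<psi>1, G, G') \<in> aa_triples d r" "follows b \<psi>1" by (rule actsE)
  have G: "adm G" "adm G'" "forest_iso d r G G' \<psi>1" and E: "adm E" "adm E'" "forest_iso d r E E' \<psi>2"
    using 1 2 by (auto simp: triples_iff)
  have "finite E" "E \<subseteq> T" using E(1) by (auto simp: admissible_def)
  with G obtain F1 F2 where F: "adm F1" "adm F2" "E \<subseteq> F2" "forest_iso d r F1 F2 \<psi>1"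
    by (rule enlarge_representative)
  note R = forest_iso_restrict[OF E F(2,3)]
  have fin: "finite F1" "finite F2" using F by (auto simp: admissible_def)
  have "(restrict \<psi>1 (forest F1), F1, F2) \<in> cls b"
    using triples_restrict[OF F(1,2,4)] follows_restrict[OF 1(2) fin(1)] by (simp add: cls_def)
  moreover have "(restrict \<psi>2 (forest F2), F2, T - \<psi>2 ` forest F2) \<in> cls a"
    using triples_restrict[OF F(2) R(1,3)] follows_restrict[OF 2(2) fin(2)] by (simp add: cls_def)
  ultimately show ?thesis using that by blast
qed

text \<open>All the classes united in the definition of the product coincide, and there is at least
  one, so the union is a single class.\<close>

lemma mult_cls:
  assumes a: "a \<in> acts" and b: "b \<in> acts"
  shows "a \<circ> b \<in> acts" "cls a \<otimes>\<^bsub>neretin_group d r\<^esub> cls b = cls (a \<circ> b)"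
proof -
  have bm: "ball_map (a \<circ> b)" using a b by (intro ball_map_comp) (auto simp: acts_def)
  let ?Z = "{aa_rel d r `` {(compose (forest F1) \<psi>2 \<psi>1, F1, F3)} | \<psi>1 \<psi>2 F1 F2 F3.
     (\<psi>2, F2, F3) \<in> cls a \<and> (\<psi>1, F1, F2) \<in> cls b}"
  have one: "aa_rel d r `` {(compose (forest F1) \<psi>2 \<psi>1, F1, F3)} = cls (a \<circ> b)"
    if "(\<psi>2, F2, F3) \<in> cls a" "(\<psi>1, F1, F2) \<in> cls b" for \<psi>1 \<psi>2 F1 F2 F3
  proof (rule class_eq_cls)
    have "(\<psi>2, F2, F3) \<in> aa_triples d r" "(\<psi>1, F1, F2) \<in> aa_triples d r" "follows a \<psi>2" "follows b \<psi>1"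
      using that by (auto simp: cls_def)
    from follows_comp[OF this]
    show "(compose (forest F1) \<psi>2 \<psi>1, F1, F3) \<in> aa_triples d r"
      "follows (a \<circ> b) (compose (forest F1) \<psi>2 \<psi>1)" .
  qed
  obtain \<psi>1 \<psi>2 F1 F2 F3 where rep: "(\<psi>2, F2, F3) \<in> cls a" "(\<psi>1, F1, F2) \<in> cls b"
    using composable_representatives[OF a b] .
  then have "?Z = {cls (a \<circ> b)}" using one by blast
  then show "cls a \<otimes>\<^bsub>neretin_group d r\<^esub> cls b = cls (a \<circ> b)"
    by (simp add: neretin_group_def)
  have "follows (a \<circ> b) (compose (forest F1) \<psi>2 \<psi>1)" "(compose (forest F1) \<psi>2 \<psi>1, F1, F3) \<in> aa_triples d r"
    using follows_comp[of \<psi>2 F2 F3 \<psi>1 F1 a b] rep by (auto simp: cls_def)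
  then show "a \<circ> b \<in> acts" using actsI[OF bm] by blast
qed

lemma one_cls: "id \<in> acts" "\<one>\<^bsub>neretin_group d r\<^esub> = cls id"
proof -
  have adm: "adm {}" by (simp add: admissible_def)
  have iso: "forest_iso d r {} {} id" by (simp add: forest_iso_iff[OF adm adm])
  have t: "(restrict id (forest {}), {}, {}) \<in> aa_triples d r" by (rule triples_restrict[OF adm adm iso])
  have f: "follows id (restrict id (forest {}))"
    by (rule follows_restrict) (auto simp: follows_def)
  show "id \<in> acts" by (rule actsI[OF ball_map_id t f])
  show "\<one>\<^bsub>neretin_group d r\<^esub> = cls id"
    using class_eq_cls[OF t f] by (simp add: neretin_group_def)
qed

lemma acts_inverse:
  assumes "a \<in> acts"
  obtains b where "b \<in> acts" "a \<circ> b = id" "b \<circ> a = id"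
proof -
  from assms obtain \<psi> F F' where a: "ball_map a" "follows a \<psi>" and t: "(\<psi>, F, F') \<in> aa_triples d r"
    by (rule actsE)
  then have F: "adm F" "adm F'" "forest_iso d r F F' \<psi>" by (auto simp: triples_iff)
  then have bij: "bij_betw \<psi> (forest F) (forest F')" by (auto simp: forest_iso_iff)
  let ?\<phi> = "restrict (inv_into (forest F) \<psi>) (forest F')"
  have t': "(?\<phi>, F', F) \<in> aa_triples d r"
    by (rule triples_restrict[OF F(2,1) forest_iso_inverse[OF F]])
  then obtain b where b: "ball_map b" "follows b ?\<phi>" using follows_exists by blast
  \<comment> \<open>Each composite with the candidate inverse is the identity on a cofinite forest,
    hence followed by \<open>id\<close>; uniqueness extends this to all balls.\<close>
  have follows_id: "follows id (compose (forest A) f g)"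
    if "\<And>v. v \<in> forest A \<Longrightarrow> f (g v) = v" "adm A" for A f g
  proof -
    have "compose (forest A) f g v = v" if "v \<in> T'" "v \<notin> A" for v
    proof -
      have "v \<in> forest A" using that by (simp add: cofinite_forest_def)
      then show ?thesis using \<open>\<And>v. v \<in> forest A \<Longrightarrow> f (g v) = v\<close> by (simp add: compose_eq)
    qed
    then have "v \<in> A" if "v \<in> {v \<in> T'. id (Cone v) \<noteq> Cone (compose (forest A) f g v)}" for v
      using that by fastforce
    then have "{v \<in> T'. id (Cone v) \<noteq> Cone (compose (forest A) f g v)} \<subseteq> A" by (rule subsetI)
    then show ?thesis using that(2) unfolding follows_def admissible_def by (auto intro: finite_subset)
  qed
  have im: "\<psi> v \<in> forest F'" if "v \<in> forest F" for v using bij that by (auto dest: bij_betwE)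
  have "a \<circ> b = id"
  proof (rule follows_unique[OF ball_map_comp[OF a(1) b(1)] ball_map_id])
    show "follows (a \<circ> b) (compose (forest F') \<psi> ?\<phi>)" by (rule follows_comp[OF t t' a(2) b(2)])
    show "follows id (compose (forest F') \<psi> ?\<phi>)"
      using bij_betw_inv_into_right[OF bij] by (intro follows_id F) simp
  qed
  moreover have "b \<circ> a = id"
  proof (rule follows_unique[OF ball_map_comp[OF b(1) a(1)] ball_map_id])
    show "follows (b \<circ> a) (compose (forest F) ?\<phi> \<psi>)" by (rule follows_comp[OF t' t b(2) a(2)])
    show "follows id (compose (forest F) ?\<phi> \<psi>)"
      using bij_betw_inv_into_left[OF bij] im by (intro follows_id F) simp
  qed
  moreover have "b \<in> acts" by (rule actsI[OF b(1) t' b(2)])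
  ultimately show ?thesis using that by blast
qed

lemma group_neretin: "group (neretin_group d r)"
proof (rule groupI)
  fix x y z assume "x \<in> carrier (neretin_group d r)" "y \<in> carrier (neretin_group d r)"
    "z \<in> carrier (neretin_group d r)"
  then obtain a b c where *: "a \<in> acts" "b \<in> acts" "c \<in> acts" "x = cls a" "y = cls b" "z = cls c"
    by (auto simp: carrier_neretin)
  then show "x \<otimes>\<^bsub>neretin_group d r\<^esub> y \<otimes>\<^bsub>neretin_group d r\<^esub> z =
    x \<otimes>\<^bsub>neretin_group d r\<^esub> (y \<otimes>\<^bsub>neretin_group d r\<^esub> z)"
    by (simp add: mult_cls o_assoc)
next
  fix x assume "x \<in> carrier (neretin_group d r)"
  then obtain a where a: "a \<in> acts" "x = cls a" by (auto simp: carrier_neretin)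
  then show "\<one>\<^bsub>neretin_group d r\<^esub> \<otimes>\<^bsub>neretin_group d r\<^esub> x = x"
    by (simp add: one_cls mult_cls)
  obtain b where b: "b \<in> acts" "b \<circ> a = id" using acts_inverse[OF a(1)] by blast
  then have "cls b \<otimes>\<^bsub>neretin_group d r\<^esub> x = \<one>\<^bsub>neretin_group d r\<^esub>"
    using a by (simp add: one_cls mult_cls)
  then show "\<exists>y\<in>carrier (neretin_group d r). y \<otimes>\<^bsub>neretin_group d r\<^esub> x = \<one>\<^bsub>neretin_group d r\<^esub>"
    using b(1) by (auto simp: carrier_neretin)
qed (auto simp: carrier_neretin mult_cls one_cls)


section \<open>The invariant vertex\<close>

definition cones :: "ball set" where "cones = Cone ` T'"

definition vertices :: "ball set set" where
  "vertices = {D. D \<subseteq> Collect normal \<and> finite (D - cones) \<and> finite (cones - D) \<and>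
     (\<forall>b\<in>D. ch b \<subseteq> D) \<and> (\<forall>b\<in>D. \<forall>b'\<in>D. ch b \<inter> ch b' \<noteq> {} \<longrightarrow> b = b')}"

lemma verticesD:
  assumes "D \<in> vertices"
  shows "b \<in> D \<Longrightarrow> normal b" "finite (D - cones)" "finite (cones - D)" "b \<in> D \<Longrightarrow> c \<in> ch b \<Longrightarrow> c \<in> D"
    "b \<in> D \<Longrightarrow> b' \<in> D \<Longrightarrow> c \<in> ch b \<Longrightarrow> c \<in> ch b' \<Longrightarrow> b = b'"
  using assms unfolding vertices_def by blast+

lemma verticesI:
  assumes "\<And>b. b \<in> D \<Longrightarrow> normal b" "finite (D - cones)" "finite (cones - D)"
    "\<And>b c. b \<in> D \<Longrightarrow> c \<in> ch b \<Longrightarrow> c \<in> D"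
    "\<And>b b' c. b \<in> D \<Longrightarrow> b' \<in> D \<Longrightarrow> c \<in> ch b \<Longrightarrow> c \<in> ch b' \<Longrightarrow> b = b'"
  shows "D \<in> vertices"
  using assms unfolding vertices_def by blast

text \<open>The parent of a cone is a cone unless the vertex is a child of the root. So an orphan
  cone sits at the top of the tree or below one of the finitely many cones missing from
  \<open>V\<close>.\<close>

lemma finite_orphans:
  assumes V: "V \<in> vertices"
  shows "finite {b \<in> V. \<forall>b'\<in>V. b \<notin> ch b'}" (is "finite ?P")
proof (rule finite_subset)
  \<comment> \<open>The bound 2 captures the children of the root, whose parent is no ball.\<close>
  show "?P \<subseteq> (V - cones) \<union> Cone ` {v \<in> T. length v < 2} \<union> (\<Union>b\<in>cones - V. ch b)"
  proof
    fix b assume b: "b \<in> ?P"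
    show "b \<in> (V - cones) \<union> Cone ` {v \<in> T. length v < 2} \<union> (\<Union>b\<in>cones - V. ch b)"
    proof (cases "b \<in> cones")
      case True
      then obtain v where v: "b = Cone v" "v \<in> T" "v \<noteq> []" by (auto simp: cones_def)
      then obtain u i where u: "v = u @ [i]" by (metis rev_exhaust)
      show ?thesis
      proof (cases "u = []")
        case False
        have "u \<in> T'" using v u False by (simp add: snoc_in_T)
        moreover have "b \<in> ch (Cone u)" using v u by (auto simp: kids_def)
        moreover from this have "Cone u \<notin> V" using b by blast
        ultimately have "Cone u \<in> cones - V" "b \<in> ch (Cone u)" by (auto simp: cones_def)
        then show ?thesis by blast
      qed (use u v in auto)
    qed (use b in blast)
  qed
  show "finite ((V - cones) \<union> Cone ` {v \<in> T. length v < 2} \<union> (\<Union>b\<in>cones - V. ch b))"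
    using verticesD(2,3)[OF V] finite_T_length[of 2] finite_ch by blast
qed

lemma ex_max_rank:
  assumes "finite Q" "Q \<noteq> {}"
  shows "\<exists>b\<in>Q. \<forall>c\<in>Q. rank c \<le> rank b"
proof -
  have "Max (rank ` Q) \<in> rank ` Q" using assms by simp
  then obtain b where "b \<in> Q" "rank b = Max (rank ` Q)" by auto
  then show ?thesis using assms(1) by (intro bexI[of _ b]) auto
qed

lemma rank_ch_asym: "c \<in> ch b \<Longrightarrow> rank b \<le> rank c \<Longrightarrow> False"
  using rank_ch by force

lemma cones_in_vertices: "cones \<in> vertices"
proof (rule verticesI)
  fix b c assume b: "b \<in> cones" and c: "c \<in> ch b"
  from b obtain v where "b = Cone v" unfolding cones_def by blast
  with c have "c \<in> Cone ` kids v" by simp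
  then show "c \<in> cones" using kids_subset unfolding cones_def by blast
next
  fix b b' c assume "b \<in> cones" "b' \<in> cones" "c \<in> ch b" "c \<in> ch b'"
  then show "b = b'" using kids_disjoint by (auto simp: cones_def)
qed (auto simp: cones_def)

text \<open>A removable ball is an orphan. An addable ball has only orphans as children, since they
  must lie in \<open>V\<close> and may not acquire a second parent; by \<open>ch_inj\<close> such
  balls are no more numerous than the sets of orphans.\<close>

lemma finite_neighbours_vertices:
  assumes V: "V \<in> vertices"
  shows "finite {b. sym_diff V {b} \<in> vertices}"
proof -
  let ?P = "{b \<in> V. \<forall>b'\<in>V. b \<notin> ch b'}"
  have "{b. sym_diff V {b} \<in> vertices} \<subseteq> ?P \<union> {b. normal b \<and> ch b \<subseteq> ?P}"
  proof
    fix b assume "b \<in> {b. sym_diff V {b} \<in> vertices}"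
    then have W: "sym_diff V {b} \<in> vertices" by simp
    show "b \<in> ?P \<union> {b. normal b \<and> ch b \<subseteq> ?P}"
    proof (cases "b \<in> V")
      case True
      have "b \<notin> ch b'" if "b' \<in> V" for b'
      proof
        assume b': "b \<in> ch b'"
        then have "b' \<in> sym_diff V {b}" using that rank_ch_asym by auto
        then have "b \<in> sym_diff V {b}" using verticesD(4)[OF W _ b'] by blast
        then show False using True by simp
      qed
      then show ?thesis using True by blast
    next
      case False
      then have bW: "b \<in> sym_diff V {b}" by simp
      have "c \<in> ?P" if c: "c \<in> ch b" for c
      proof -
        have "c \<noteq> b" using rank_ch_asym c by blast
        then have "c \<in> V" using verticesD(4)[OF W bW c] by simp
        moreover have "c \<notin> ch b'" if b': "b' \<in> V" for b'
        proof
          assume "c \<in> ch b'"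
          moreover have "b' \<in> sym_diff V {b}" using b' False by auto
          ultimately have "b = b'" using verticesD(5)[OF W bW _ c] by blast
          then show False using b' False by simp
        qed
        ultimately show ?thesis by blast
      qed
      then show ?thesis using verticesD(1)[OF W bW] by blast
    qed
  qed
  moreover have "finite {b. normal b \<and> ch b \<subseteq> ?P}"
  proof (rule finite_imageD)
    have "ch ` {b. normal b \<and> ch b \<subseteq> ?P} \<subseteq> Pow ?P" by blast
    then show "finite (ch ` {b. normal b \<and> ch b \<subseteq> ?P})"
      by (rule finite_subset) (simp only: finite_Pow_iff finite_orphans[OF V])
    show "inj_on ch {b. normal b \<and> ch b \<subseteq> ?P}" by (rule inj_onI) (blast intro: ch_inj)
  qed
  ultimately show ?thesis using finite_orphans[OF V] by (meson finite_UnI finite_subset)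
qed

text \<open>A ball \<open>b\<close> of largest rank in \<open>Q\<close> can be removed: a parent of
  it cannot lie in \<open>Q\<close> by the choice of rank, nor in \<open>W\<close>, which is closed
  under children and does not contain \<open>b\<close>.\<close>

lemma peel_vertices:
  assumes W: "W \<in> vertices" and Q: "finite Q" "Q \<noteq> {}" "Q \<inter> W = {}"
  shows "\<exists>b\<in>Q. \<forall>V\<in>vertices. b \<in> V \<longrightarrow> W \<subseteq> V \<longrightarrow> V \<subseteq> W \<union> Q \<longrightarrow> V - {b} \<in> vertices"
proof -
  obtain b where b: "b \<in> Q" and max: "\<And>c. c \<in> Q \<Longrightarrow> rank c \<le> rank b"
    using ex_max_rank[OF Q(1,2)] by blast
  have "V - {b} \<in> vertices" if V: "V \<in> vertices" "V \<subseteq> W \<union> Q" for V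
  proof (rule verticesI)
    fix c c' assume c: "c \<in> V - {b}" "c' \<in> ch c"
    have "c' \<noteq> b"
    proof
      assume "c' = b"
      then have "b \<in> ch c" using c by simp
      then have "c \<notin> Q" using rank_ch_asym max by blast
      then have "c \<in> W" using c V by blast
      then have "b \<in> W" using verticesD(4)[OF W] \<open>b \<in> ch c\<close> by blast
      then show False using b Q by blast
    qed
    then show "c' \<in> V - {b}" using verticesD(4)[OF V(1)] c by blast
  next
    show "finite (V - {b} - cones)" using verticesD(2)[OF V(1)] by (rule finite_subset[rotated]) blast
    have "cones - (V - {b}) \<subseteq> insert b (cones - V)" by blast
    then show "finite (cones - (V - {b}))" using verticesD(3)[OF V(1)] by (meson finite_insert finite_subset)
  qed (use verticesD(1,5)[OF V(1)] in blast)+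
  then show ?thesis using b by blast
qed

lemma inter_vertices:
  assumes V: "V \<in> vertices" and W: "W \<in> vertices"
  shows "V \<inter> W \<in> vertices"
proof (rule verticesI)
  show "finite (V \<inter> W - cones)" using verticesD(2)[OF V] by (rule finite_subset[rotated]) blast
  have "cones - V \<inter> W = (cones - V) \<union> (cones - W)" by blast
  then show "finite (cones - V \<inter> W)" using verticesD(3)[OF V] verticesD(3)[OF W] by simp
qed (use verticesD(1,4,5)[OF V] verticesD(4)[OF W] in blast)+

text \<open>Two elements of the median each lie in at least two of the three sets, hence together in
  one of them. This is why uniqueness of parents survives.\<close>

lemma median_vertices:
  assumes U: "U \<in> vertices" and V: "V \<in> vertices" and W: "W \<in> vertices"
  shows "(U \<inter> V) \<union> (V \<inter> W) \<union> (U \<inter> W) \<in> vertices" (is "?M \<in> _")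
proof (rule verticesI)
  show "finite (?M - cones)"
    using verticesD(2)[OF U] verticesD(2)[OF V] by (intro finite_subset[of "?M - cones" "(U - cones) \<union> (V - cones)"]) auto
  show "finite (cones - ?M)"
    using verticesD(3)[OF U] verticesD(3)[OF V] by (intro finite_subset[of "cones - ?M" "(cones - U) \<union> (cones - V)"]) auto
  show "normal b" if "b \<in> ?M" for b using that verticesD(1)[OF U] verticesD(1)[OF V] by blast
  show "c \<in> ?M" if "b \<in> ?M" "c \<in> ch b" for b c
    using that verticesD(4)[OF U, of b c] verticesD(4)[OF V, of b c] verticesD(4)[OF W, of b c] by blast
  show "b = b'" if "b \<in> ?M" "b' \<in> ?M" "c \<in> ch b" "c \<in> ch b'" for b b' c
    using that verticesD(5)[OF U, of b b' c] verticesD(5)[OF V, of b b' c] verticesD(5)[OF W, of b b' c] by blast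
qed

lemma median_family_vertices:
  assumes "inj code"
  shows "median_family vertices code"
proof
  show "vertices \<noteq> {}" using cones_in_vertices by blast
  show "finite (V - W)" if "V \<in> vertices" "W \<in> vertices" for V W
    using verticesD(2)[OF that(1)] verticesD(3)[OF that(2)]
    by (intro finite_subset[of "V - W" "(V - cones) \<union> (cones - W)"]) auto
qed (fact assms inter_vertices median_vertices peel_vertices finite_neighbours_vertices)+

section \<open>The action on vertices and the invariant forest\<close>

lemma bij_acts: "a \<in> acts \<Longrightarrow> bij a"
  by (rule acts_inverse) (auto intro: o_bij)

lemma acts_ball_map: "a \<in> acts \<Longrightarrow> ball_map a"
  by (simp add: acts_def)

lemma finite_image_cones:
  assumes a: "a \<in> acts"
  shows "finite (a ` cones - cones)"
proof -
  obtain \<psi> F F' where t: "(\<psi>, F, F') \<in> aa_triples d r" and f: "follows a \<psi>" using actsE[OF a] by metis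
  have F: "adm F" "adm F'" "forest_iso d r F F' \<psi>" using t by (auto simp: triples_iff)
  let ?X = "{v \<in> T'. a (Cone v) \<noteq> Cone (\<psi> v)} \<union> F \<union> {v \<in> forest F. \<psi> v \<in> {[]}}"
  have "finite ?X"
    using f F(1) finite_preimage[OF F, of "{[]}"] by (simp add: follows_def admissible_def)
  moreover have "a ` cones - cones \<subseteq> (\<lambda>v. a (Cone v)) ` ?X"
  proof
    fix b assume b: "b \<in> a ` cones - cones"
    then obtain v where v: "v \<in> T'" "b = a (Cone v)" by (auto simp: cones_def)
    have "v \<in> ?X"
    proof (rule ccontr)
      assume nX: "v \<notin> ?X"
      then have vF: "v \<in> forest F" and av: "b = Cone (\<psi> v)" using v by (auto simp: cofinite_forest_def)
      then have "\<psi> v \<in> forest F'" using F(3) by (auto simp: forest_iso_def dest: bij_betwE)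
      then have "\<psi> v \<in> T'" using nX vF by (auto simp: cofinite_forest_def)
      then show False using b av by (auto simp: cones_def)
    qed
    then show "b \<in> (\<lambda>v. a (Cone v)) ` ?X" using v(2) by blast
  qed
  ultimately show ?thesis by (meson finite_imageI finite_subset)
qed

lemma image_vertices:
  assumes a: "a \<in> acts" and V: "V \<in> vertices"
  shows "a ` V \<in> vertices"
proof -
  obtain a' where a': "a' \<in> acts" "a \<circ> a' = id" "a' \<circ> a = id" using acts_inverse[OF a] by metis
  have aa': "a (a' b) = b" "a' (a b) = b" for b using a' by (auto simp: fun_eq_iff)
  have bm: "ball_map a" by (rule acts_ball_map[OF a])
  have inj: "a b = a c \<longleftrightarrow> b = c" for b c using aa' by metis
  have chV: "\<exists>w\<in>ch v. c = a w" if "v \<in> V" "c \<in> ch (a v)" for v c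
    using that ball_mapD(2)[OF bm verticesD(1)[OF V that(1)]] by blast
  show ?thesis
  proof (rule verticesI)
    show "normal b" if "b \<in> a ` V" for b using that ball_mapD(1)[OF bm] verticesD(1)[OF V] by blast
    have "a ` V - cones \<subseteq> a ` (V - cones) \<union> (a ` cones - cones)" by blast
    then show "finite (a ` V - cones)"
      using verticesD(2)[OF V] finite_image_cones[OF a] by (meson finite_UnI finite_imageI finite_subset)
    \<comment> \<open>Pulled back by the inverse, a cone missing from the image either ceases to be
      a cone or is a cone missing from \<open>V\<close>; both happen only finitely often.\<close>
    have "cones - a ` V \<subseteq> a ` ((a' ` cones - cones) \<union> (cones - V))"
    proof
      fix b assume b: "b \<in> cones - a ` V"
      have "a' b \<notin> V" using b aa'(1)[of b] by (metis DiffD2 imageI)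
      moreover have "a' b \<in> a' ` cones" using b by blast
      ultimately have "a' b \<in> (a' ` cones - cones) \<union> (cones - V)" by blast
      then show "b \<in> a ` ((a' ` cones - cones) \<union> (cones - V))" using aa'(1)[of b] by (metis imageI)
    qed
    then show "finite (cones - a ` V)"
      using verticesD(3)[OF V] finite_image_cones[OF a'(1)] by (meson finite_UnI finite_imageI finite_subset)
  next
    fix b c assume b: "b \<in> a ` V" and c: "c \<in> ch b"
    from b obtain v where v: "v \<in> V" "b = a v" by blast
    then obtain w where "w \<in> ch v" "c = a w" using chV c by blast
    then show "c \<in> a ` V" using verticesD(4)[OF V v(1)] by blast
  next
    fix b b' c assume b: "b \<in> a ` V" "b' \<in> a ` V" and c: "c \<in> ch b" "c \<in> ch b'"
    from b obtain v v' where v: "v \<in> V" "b = a v" and v': "v' \<in> V" "b' = a v'" by blast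
    from c obtain w w' where w: "w \<in> ch v" "c = a w" "w' \<in> ch v'" "c = a w'"
      using chV[OF v(1)] chV[OF v'(1)] unfolding v(2) v'(2) by blast
    then have "w = w'" using inj by simp
    then show "b = b'" using verticesD(5)[OF V v(1) v'(1) w(1)] w(3) v v' by simp
  qed
qed

text \<open>Passing to the children drops exactly the orphans. There are finitely many, so the
  distance to the set of cones stays finite.\<close>

lemma children_vertices:
  assumes V: "V \<in> vertices"
  shows "(\<Union>b\<in>V. ch b) \<in> vertices" "(\<Union>b\<in>V. ch b) \<subseteq> V"
proof -
  let ?V = "\<Union>b\<in>V. ch b"
  show sub: "?V \<subseteq> V" using verticesD(4)[OF V] by blast
  show "?V \<in> vertices"
  proof (rule verticesI)
    show "finite (?V - cones)" using verticesD(2)[OF V] by (rule finite_subset[rotated]) (use sub in blast)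
    have "cones - ?V \<subseteq> (cones - V) \<union> {b \<in> V. \<forall>b'\<in>V. b \<notin> ch b'}" by blast
    then show "finite (cones - ?V)"
      using verticesD(3)[OF V] finite_orphans[OF V] by (meson finite_UnI finite_subset)
    show "normal b" if "b \<in> ?V" for b using that sub verticesD(1)[OF V] by blast
    show "c \<in> ?V" if "b \<in> ?V" "c \<in> ch b" for b c using that sub by blast
    show "b = b'" if "b \<in> ?V" "b' \<in> ?V" "c \<in> ch b" "c \<in> ch b'" for b b' c
      using that sub verticesD(5)[OF V, of b b' c] by blast
  qed
qed

lemma invariant_subset_of_cones:
  assumes "V \<in> vertices" and H: "\<And>a. a \<in> H \<Longrightarrow> a \<in> acts" and inv: "\<And>a. a \<in> H \<Longrightarrow> a ` V = V"
  shows "\<exists>D\<in>vertices. D \<subseteq> cones \<and> (\<forall>a\<in>H. a ` D = D)"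
  using assms(1) inv
proof (induction "card (V - cones)" arbitrary: V rule: less_induct)
  case less
  show ?case
  proof (cases "V - cones = {}")
    case True
    then have "V \<subseteq> cones" by blast
    then show ?thesis using less.prems by (intro bexI[of _ V]) simp_all
  next
    case False
    let ?W = "\<Union>b\<in>V. ch b"
    have fin: "finite (V - cones)" using verticesD(2)[OF less.prems(1)] .
    obtain b where b: "b \<in> V - cones" and max: "\<And>c. c \<in> V - cones \<Longrightarrow> rank c \<le> rank b"
      using ex_max_rank[OF fin False] by blast
    have "b \<notin> ?W"
    proof
      assume "b \<in> ?W"
      then obtain b' where b': "b' \<in> V" "b \<in> ch b'" by blast
      \<comment> \<open>A parent has larger rank, so by the choice of \<open>b\<close> it must be a
        cone; but children of cones are cones.\<close>
      have "b' \<in> cones" using rank_ch_asym[OF b'(2)] max[of b'] b'(1) by blast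
      then have "b \<in> cones" using verticesD(4)[OF cones_in_vertices] b'(2) by blast
      then show False using b by blast
    qed
    then have "?W - cones \<subset> V - cones" using children_vertices(2)[OF less.prems(1)] b by blast
    then have "card (?W - cones) < card (V - cones)" by (rule psubset_card_mono[OF fin])
    moreover have "a ` ?W = ?W" if a: "a \<in> H" for a
    proof -
      have "a ` ?W = (\<Union>b\<in>V. a ` ch b)" by blast
      also have "\<dots> = (\<Union>b\<in>V. ch (a b))"
        using ball_mapD(2)[OF acts_ball_map[OF H[OF a]]] verticesD(1)[OF less.prems(1)] by auto
      also have "\<dots> = (\<Union>b\<in>a ` V. ch b)" by blast
      finally show ?thesis using less.prems(2)[OF a] by simp
    qed
    ultimately show ?thesis using less.hyps[of ?W, OF _ children_vertices(1)[OF less.prems(1)]] by simp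
  qed
qed

text \<open>Closure of \<open>D\<close> under children makes the complement closed under parents.
  The root is put in by hand, so that the remaining forest is exactly the set of vertices whose
  cones lie in \<open>D\<close>.\<close>

lemma admissible_complement:
  assumes D: "D \<in> vertices"
  shows "adm (insert [] {v \<in> T'. Cone v \<notin> D})" (is "adm ?F")
proof -
  have "Cone ` {v \<in> T'. Cone v \<notin> D} \<subseteq> cones - D" by (auto simp: cones_def)
  then have "finite (Cone ` {v \<in> T'. Cone v \<notin> D})" using verticesD(3)[OF D] by (rule finite_subset)
  then have fin: "finite {v \<in> T'. Cone v \<notin> D}" by (rule finite_imageD) (simp add: inj_on_def)
  have "u \<in> ?F" if u: "u @ [i] \<in> ?F" for u i
  proof (cases "u = []")
    case False
    have "u \<in> T'" "u @ [i] \<in> kids u" using u False by (auto simp: snoc_in_T kids_def)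
    moreover have "Cone u \<notin> D" using u verticesD(4)[OF D, of "Cone u" "Cone (u @ [i])"] calculation(2) by auto
    ultimately show ?thesis by simp
  qed simp
  then show ?thesis using fin Nil_in_T unfolding admissible_def by blast
qed

text \<open>As \<open>D\<close> contains only cones, the permutation of \<open>D\<close> by
  \<open>a\<close> is a permutation of vertices, and compatibility with \<open>ch\<close> is
  compatibility with \<open>kids\<close>. The representative so obtained has the same source and
  target, whatever representative \<open>a\<close> came from.\<close>

lemma cls_in_forest_aut_group:
  assumes D: "D \<in> vertices" "D \<subseteq> cones" and a: "a \<in> acts" "a ` D = D"
  shows "cls a \<in> forest_aut_group d r (insert [] {v \<in> T'. Cone v \<notin> D})" (is "_ \<in> forest_aut_group d r ?F")
proof -
  have F: "adm ?F" by (rule admissible_complement[OF D(1)])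
  have forest: "v \<in> forest ?F \<longleftrightarrow> v \<in> T' \<and> Cone v \<in> D" for v by (auto simp: cofinite_forest_def)
  define \<psi> where "\<psi> v = (THE w. a (Cone v) = Cone w)" for v
  have \<psi>: "a (Cone v) = Cone (\<psi> v)" "\<psi> v \<in> forest ?F" if v: "v \<in> forest ?F" for v
  proof -
    have "Cone v \<in> D" using v by (simp only: forest)
    then have aD: "a (Cone v) \<in> D" using a(2) by blast
    then obtain w where w: "w \<in> T'" "a (Cone v) = Cone w" using D(2) by (auto simp: cones_def)
    then show "a (Cone v) = Cone (\<psi> v)" by (simp add: \<psi>_def)
    with w have "\<psi> v = w" by simp
    then show "\<psi> v \<in> forest ?F" unfolding forest using w aD by simp
  qed
  have "bij_betw \<psi> (forest ?F) (forest ?F)"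
  proof (rule bij_betw_imageI)
    show "inj_on \<psi> (forest ?F)"
    proof (rule inj_onI)
      fix v w assume vw: "v \<in> forest ?F" "w \<in> forest ?F" "\<psi> v = \<psi> w"
      then have "a (Cone v) = a (Cone w)" using \<psi>(1) by simp
      then show "v = w" using bij_acts[OF a(1)] by (auto dest: bij_is_inj injD)
    qed
    have "w \<in> \<psi> ` forest ?F" if w: "w \<in> forest ?F" for w
    proof -
      have "Cone w \<in> D" using w by (simp only: forest)
      then have "Cone w \<in> a ` D" using a(2) by simp
      then obtain b where b: "b \<in> D" "Cone w = a b" by blast
      then obtain v where v: "v \<in> T'" "b = Cone v" using D(2) by (auto simp: cones_def)
      then have "v \<in> forest ?F" unfolding forest using b by simp
      moreover have "\<psi> v = w" using \<psi>(1)[OF calculation] b v by simp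
      ultimately show ?thesis by blast
    qed
    then show "\<psi> ` forest ?F = forest ?F" using \<psi>(2) by blast
  qed
  moreover have "\<psi> ` kids v = kids (\<psi> v)" if v: "v \<in> forest ?F" for v
  proof -
    have "Cone ` kids (\<psi> v) = ch (a (Cone v))" using \<psi>(1)[OF v] by simp
    also have "\<dots> = a ` Cone ` kids v"
      using ball_mapD(2)[OF acts_ball_map[OF a(1)], of "Cone v"] v[unfolded forest] by simp
    also have "\<dots> = Cone ` \<psi> ` kids v"
      unfolding image_image using \<psi>(1) forest_kids[OF F v] by (intro image_cong) auto
    finally show ?thesis using inj_Cone by (simp add: inj_image_eq_iff)
  qed
  ultimately have "forest_iso d r ?F ?F \<psi>" unfolding forest_iso_iff[OF F F] by blast
  then have t: "(restrict \<psi> (forest ?F), ?F, ?F) \<in> aa_triples d r" by (rule triples_restrict[OF F F])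
  have "{v \<in> T'. a (Cone v) \<noteq> Cone (restrict \<psi> (forest ?F) v)} \<subseteq> ?F"
  proof
    fix v assume v: "v \<in> {v \<in> T'. a (Cone v) \<noteq> Cone (restrict \<psi> (forest ?F) v)}"
    then have "v \<notin> forest ?F" using \<psi>(1)[of v] by auto
    then show "v \<in> ?F" using v by (simp add: cofinite_forest_def)
  qed
  then have "follows a (restrict \<psi> (forest ?F))"
    unfolding follows_def by (rule finite_subset) (use F in \<open>simp add: admissible_def\<close>)
  with t have "(restrict \<psi> (forest ?F), ?F, ?F) \<in> cls a" by (simp add: cls_def)
  moreover have "cls a \<in> carrier (neretin_group d r)" using a(1) by (simp add: carrier_neretin)
  ultimately show ?thesis unfolding forest_aut_group_def by blast
qed

theorem FW_LocFin_subgroup: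
  assumes H: "subgroup H (neretin_group d r)" and FW: "FW_LocFin ((neretin_group d r)\<lparr>carrier := H\<rparr>)"
  shows "\<exists>F. adm F \<and> H \<subseteq> forest_aut_group d r F"
proof -
  let ?G = "(neretin_group d r)\<lparr>carrier := H\<rparr>"
  obtain code :: "(ball \<Rightarrow> real) \<Rightarrow> real" where "inj code" using ex_inj_countable_functions_real by blast
  then interpret median_family vertices code by (rule median_family_vertices)
  \<comment> \<open>Recovers the permutation of balls from an element of the group; multiplicativity
    of \<open>cls\<close> makes this an action.\<close>
  define act where "act = inv_into acts cls"
  have HC: "H \<subseteq> cls ` acts" using subgroup.subset[OF H] by (simp add: carrier_neretin)
  have act: "act A \<in> acts" "cls (act A) = A" if "A \<in> H" for A
    using that HC by (auto simp: act_def inv_into_into f_inv_into_f)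
  have act_cls: "act (cls a) = a" if "a \<in> acts" for a
    using that by (simp add: act_def inv_into_f_f[OF inj_on_cls])
  have "\<exists>V\<in>vertices. \<forall>A\<in>carrier ?G. act A ` V = V"
  proof (rule FW_LocFin_imp_invariant_vertex[OF _ FW, of act])
    show "group ?G" by (rule subgroup.subgroup_is_group[OF H group_neretin])
    show "bij (act A)" if "A \<in> carrier ?G" for A using that act(1) bij_acts by simp
    show "act A ` V \<in> vertices" if "A \<in> carrier ?G" "V \<in> vertices" for A V
      using that act(1) image_vertices by simp
    show "act \<one>\<^bsub>?G\<^esub> = id" by (simp add: one_cls act_cls)
    show "act (A \<otimes>\<^bsub>?G\<^esub> B) = act A \<circ> act B" if "A \<in> carrier ?G" "B \<in> carrier ?G" for A B
    proof -
      have "A \<otimes>\<^bsub>?G\<^esub> B = cls (act A) \<otimes>\<^bsub>neretin_group d r\<^esub> cls (act B)" using that act by simp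
      also have "\<dots> = cls (act A \<circ> act B)" using that act by (intro mult_cls) auto
      finally show ?thesis using act_cls mult_cls(1) act(1) that by simp
    qed
    show "\<exists>V\<in>vertices. \<forall>A\<in>carrier ?G. act A ` V = V"
      if "D \<in> vertices" "\<And>A. A \<in> carrier ?G \<Longrightarrow> act A ` D = D" for D
      using that by blast
  qed
  then obtain V where V: "V \<in> vertices" "\<And>A. A \<in> carrier ?G \<Longrightarrow> act A ` V = V" by blast
  obtain D where D: "D \<in> vertices" "D \<subseteq> cones" "\<And>A. A \<in> H \<Longrightarrow> act A ` D = D"
  proof -
    have "\<exists>D\<in>vertices. D \<subseteq> cones \<and> (\<forall>a\<in>act ` H. a ` D = D)"
      using V(2) act(1) by (intro invariant_subset_of_cones[OF V(1)]) auto
    then obtain D where "D \<in> vertices" "D \<subseteq> cones" "\<forall>a\<in>act ` H. a ` D = D" by blast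
    then show ?thesis using that[of D] by simp
  qed
  have "H \<subseteq> forest_aut_group d r (insert [] {v \<in> T'. Cone v \<notin> D})"
    using cls_in_forest_aut_group[OF D(1,2) act(1) D(3)] act(2) by auto
  then show ?thesis using admissible_complement[OF D(1)] by blast
qed

end

theorem theorem4p17:
  fixes d r :: nat and H :: "aa_triple set set"
  assumes "d \<ge> 2" and "r \<ge> 1"
    and "subgroup H (neretin_group d r)"
    and "FW_LocFin ((neretin_group d r)\<lparr>carrier := H\<rparr>)"
  shows "\<exists>F. admissible d r F \<and> H \<subseteq> forest_aut_group d r F"
proof -
  interpret neretin d r using assms(1) by unfold_locales
  show ?thesis using assms(3,4) by (rule FW_LocFin_subgroup)
qed

end
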